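(* Let $(\Omega,\mathcal{F},\mu)$ be a complete finite separable measure space and let $Y$ be a separable Banach space. Let $z\in(0,1]$, let $X:\Omega\to\mathcal{F}(Y)$ be a fuzzy mapping, $A:\Omega\times L_X\to\mathcal{F}(Y)$ a random fuzzy mapping and $a:L_X\to(0,1]$ a function with $(A(\omega,\tilde x))_{a(\tilde x)}\subset (X(\omega))_z$ for all $(\omega,\tilde x)\in\Omega\times L_X$. Suppose that: A.1) (a) $\omega\mapsto (X(\omega))_z:\Omega\to 2^Y$ is a nonempty, convex, weakly compact-valued and integrably bounded correspondence; (b) $\omega\mapsto (X(\omega))_z:\Omega\to 2^Y$ is $\mathcal{F}$-lower measurable. A.2) (a) For each $(\omega,\tilde x)\in\Omega\times L_X$, $(A(\omega,\tilde x))_{a(\tilde x)}$ is convex and has a non-empty interior in the relative norm topology of $(X(\omega))_z$; (b) the correspondence $(\omega,\tilde x)\mapsto (A(\omega,\tilde x))_{a(\tilde x)}:\Omega\times L_X\to 2^Y$ has a measurable graph, i.e. $\{(\omega,\tilde x,y): y\in (A(\omega,\tilde x))_{a(\tilde x)}\}\in\mathcal{F}\otimes\beta_w(L_X)\otimes\beta(Y)$; (c) for each $\omega\in\Omega$ and each $y\in Y$ the set $\{\tilde x\in L_X: y\in (A(\omega,\tilde x))_{a(\tilde x)}\}$ is weakly open in $L_X$; (d) for each $\omega\in\Omega$, $\tilde x\mapsto \mathrm{cl}(A(\omega,\tilde x))_{a(\tilde x)}:L_X\to 2^Y$ is upper semicontinuous in the sense that $\{\tilde x\in L_X:\mathrm{cl}(A(\omega,\tilde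 x))_{a(\tilde x)}\subset V\}$ is weakly open in $L_X$ for every norm open subset $V$ of $Y$. Then there exists $\tilde x^*\in L_X$ such that $\tilde x^*(\omega)\in\mathrm{cl}(A(\omega,\tilde x^* ))_{a(\tilde x^* )}$ for $\mu$-a.e. $\omega\in\Omega$.
   Context: Notation: $2^D$ is the set of all non-empty subsets of a set $D$; $\mathrm{cl}$ is norm closure in $Y$. $\mathcal{F}(Y)$ (not to be confused with the $\sigma$-algebra $\mathcal{F}$) is the collection of all fuzzy sets over $Y$, i.e. functions $A:Y\to[0,1]$; for $a\in[0,1]$ the $a$-cut of $A$ is $(A)_a=\{y\in Y:A(y)\ge a\}$. A fuzzy mapping is a map into $\mathcal{F}(Y)$; a fuzzy mapping $P:\Omega\times Z\to\mathcal{F}(Y)$ is a random fuzzy mapping if for every $z\in Z$ and $a\in[0,1]$ the set-valued map $\omega\mapsto (P(\omega,z))_a$ is ($\mathcal{F}$-lower) measurable. A correspondence $T:\Omega\to 2^Y$ is $\mathcal{F}$-lower measurable if $\{\omega: T(\omega)\cap V\neq\emptyset\}\in\mathcal{F}$ for every open $V\subset Y$. $T$ is integrably bounded if there is $h\in L_1(\mu,\mathbb{R})$ with $\sup\{\|x\|:x\in T(\omega)\}\le h(\omega)$ $\mu$-a.e. $L_1(\mu,Y)$ is the space of (classes of) Bochner integrable functions $\Omega\to Y$. $L_X=\{x\in L_1(\mu,Y): x(\omega)\in (X(\omega))_z\ \mu\text{-a.e.}\}$, with the weak topology of $L_1(\mu,Y)$. $\beta_w(L_X)$ is the Borel $\sigma$-algebra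 for the weak topology on $L_X$ and $\beta(Y)$ is the Borel $\sigma$-algebra for the norm topology on $Y$. *)

theory Defs
  imports "HOL-Analysis.Analysis"
begin

section \<open>Fuzzy mappings and correspondences\<close>

definition fuzzy_sets :: "('b \<Rightarrow> real) set" where
  "fuzzy_sets = {A. \<forall>y. 0 \<le> A y \<and> A y \<le> 1}"

definition level_cut :: "('b \<Rightarrow> real) \<Rightarrow> real \<Rightarrow> 'b set" where
  "level_cut A a = {y. a \<le> A y}"

definition fuzzy_mapping :: "'d set \<Rightarrow> ('d \<Rightarrow> 'b \<Rightarrow> real) \<Rightarrow> bool" where
  "fuzzy_mapping D P \<longleftrightarrow> (\<forall>d\<in>D. P d \<in> fuzzy_sets)"

text \<open>The values of \<open>T\<close> may be empty, as is needed for cuts of arbitrary fuzzy mappings.\<close>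

definition lower_measurable :: "'a measure \<Rightarrow> ('a \<Rightarrow> 'b::topological_space set) \<Rightarrow> bool" where
  "lower_measurable M T \<longleftrightarrow>
     (\<forall>V. open V \<longrightarrow> {\<omega> \<in> space M. T \<omega> \<inter> V \<noteq> {}} \<in> sets M)"

definition random_fuzzy_mapping ::
    "'a measure \<Rightarrow> 'z set \<Rightarrow> ('a \<times> 'z \<Rightarrow> 'b::topological_space \<Rightarrow> real) \<Rightarrow> bool" where
  "random_fuzzy_mapping M Z P \<longleftrightarrow>
     fuzzy_mapping (space M \<times> Z) P \<and>
     (\<forall>z\<in>Z. \<forall>a\<in>{0..1}. lower_measurable M (\<lambda>\<omega>. level_cut (P (\<omega>, z)) a))"

text \<open>The supremum is taken in the extended reals, since a supremum of an unbounded set of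
  reals is an unspecified real number.\<close>

definition integrably_bounded :: "'a measure \<Rightarrow> ('a \<Rightarrow> 'b::real_normed_vector set) \<Rightarrow> bool" where
  "integrably_bounded M T \<longleftrightarrow>
     (\<exists>h :: 'a \<Rightarrow> real. integrable M h \<and>
        (AE \<omega> in M. (SUP x\<in>T \<omega>. ereal (norm x)) \<le> ereal (h \<omega>)))"

text \<open>Separability of the measure algebra under the distance \<open>\<mu> (A \<triangle> B)\<close>.\<close>

definition separable_measure :: "'a measure \<Rightarrow> bool" where
  "separable_measure M \<longleftrightarrow>
     (\<exists>C. countable C \<and> C \<subseteq> sets M \<and>
        (\<forall>A\<in>sets M. \<forall>e>0. \<exists>B\<in>C. measure M (sym_diff A B) < e))"


section \<open>Weak topologies\<close>

definition weak_topology_on :: "'v set \<Rightarrow> ('v \<Rightarrow> real) set \<Rightarrow> 'v topology" where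
  "weak_topology_on D \<Phi> =
     topology_generated_by {{x \<in> D. \<phi> x \<in> U} | \<phi> U. \<phi> \<in> \<Phi> \<and> open U}"

definition weak_topology :: "'b::real_normed_vector topology" where
  "weak_topology = weak_topology_on UNIV {\<phi>. bounded_linear \<phi>}"


section \<open>The space of classes of Bochner integrable functions\<close>

text \<open>Equality almost everywhere only constrains functions on \<^term>\<open>space M\<close>; their values
  elsewhere are identified along with those on null sets.\<close>

definition L1_class ::
    "'a measure \<Rightarrow> ('a \<Rightarrow> 'b) \<Rightarrow> ('a \<Rightarrow> 'b::{banach, second_countable_topology}) set" where
  "L1_class M f = {g. integrable M g \<and> (AE \<omega> in M. g \<omega> = f \<omega>)}"

definition L1_space ::
    "'a measure \<Rightarrow> ('a \<Rightarrow> 'b::{banach, second_countable_topology}) set set" where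
  "L1_space M = L1_class M ` {f. integrable M f}"

text \<open>The continuous linear functionals on \<open>L\<^sub>1\<close>, with linearity and boundedness expressed through
  representatives; the vector space structure and the norm of \<open>L\<^sub>1\<close> are those induced by pointwise
  operations and \<open>f \<mapsto> \<integral> \<parallel>f\<parallel> d\<mu>\<close>.\<close>

definition L1_dual ::
    "'a measure \<Rightarrow> (('a \<Rightarrow> 'b::{banach, second_countable_topology}) set \<Rightarrow> real) set" where
  "L1_dual M = {\<phi>.
     (\<forall>f g. integrable M f \<longrightarrow> integrable M g \<longrightarrow>
        \<phi> (L1_class M (\<lambda>\<omega>. f \<omega> + g \<omega>)) = \<phi> (L1_class M f) + \<phi> (L1_class M g)) \<and>
     (\<forall>c f. integrable M f \<longrightarrow>
        \<phi> (L1_class M (\<lambda>\<omega>. c *\<^sub>R f \<omega>)) = c * \<phi> (L1_class M f)) \<and>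
     (\<exists>C. \<forall>f. integrable M f \<longrightarrow>
        \<bar>\<phi> (L1_class M f)\<bar> \<le> C * (LINT \<omega>|M. norm (f \<omega>)))}"

definition L1_weak_topology ::
    "'a measure \<Rightarrow> ('a \<Rightarrow> 'b::{banach, second_countable_topology}) set topology" where
  "L1_weak_topology M = weak_topology_on (L1_space M) (L1_dual M)"


section \<open>Integrable selections of the cut of a fuzzy mapping\<close>

text \<open>Quantifying over all representatives \<open>f\<close> of a class \<open>u\<close> is the same as picking one,
  because any two agree almost everywhere.\<close>

definition L_sel ::
    "'a measure \<Rightarrow> ('a \<Rightarrow> 'b \<Rightarrow> real) \<Rightarrow> real \<Rightarrow>
      ('a \<Rightarrow> 'b::{banach, second_countable_topology}) set set" where
  "L_sel M X z = {u \<in> L1_space M. \<forall>f\<in>u. AE \<omega> in M. f \<omega> \<in> level_cut (X \<omega>) z}"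

definition L_sel_weak ::
    "'a measure \<Rightarrow> ('a \<Rightarrow> 'b \<Rightarrow> real) \<Rightarrow> real \<Rightarrow>
      ('a \<Rightarrow> 'b::{banach, second_countable_topology}) set topology" where
  "L_sel_weak M X z = subtopology (L1_weak_topology M) (L_sel M X z)"

definition L_sel_borel ::
    "'a measure \<Rightarrow> ('a \<Rightarrow> 'b \<Rightarrow> real) \<Rightarrow> real \<Rightarrow>
      ('a \<Rightarrow> 'b::{banach, second_countable_topology}) set measure" where
  "L_sel_borel M X z = sigma (L_sel M X z) {U. openin (L_sel_weak M X z) U}"

end

theory Submission
  imports Defs
begin

text \<open>Write \<open>K \<omega>\<close> for the cut of \<open>X \<omega>\<close> and \<open>C \<omega> u\<close> for the cut of \<open>A (\<omega>, u)\<close>. The argument is a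
  Fan--Glicksberg fixed point theorem for \<open>u \<mapsto> {v. v \<omega> \<in> closure (C \<omega> u) a.e.}\<close>, which has nonempty values by
  measurable selection. It rests on one observation: from any sequence of integrable selections of \<open>K\<close>
  one can form forward convex combinations that converge weakly in \<open>K \<omega>\<close> for almost every \<open>\<omega>\<close>, obtained
  as near-minimizers of a quadratic form built from countably many functionals on \<open>Y\<close>. Functionals on
  \<open>L\<^sub>1\<close> are integrals of functionals on \<open>Y\<close>, so dominated convergence turns this into weak convergence in
  \<open>L\<^sub>1\<close>. This yields weak compactness of the set of selections, which embeds into a sequence space because
  the measure is separable, and it also shows that weak limits of points with \<open>f n \<omega>\<close> near the convex set
  \<open>C \<omega> u\<close> take values in its closure.\<close>

section \<open>Sublinear functionals and weakly lower semicontinuous distances\<close>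

definition sublinear :: "('v::real_vector \<Rightarrow> real) \<Rightarrow> bool" where
  "sublinear p \<longleftrightarrow> (\<forall>x y. p (x + y) \<le> p x + p y) \<and> (\<forall>t>0. \<forall>x. p (t *\<^sub>R x) \<le> t * p x)"

lemma sublinear_add: "sublinear p \<Longrightarrow> p (x + y) \<le> p x + p y"
  and sublinear_scale_le: "sublinear p \<Longrightarrow> 0 < t \<Longrightarrow> p (t *\<^sub>R x) \<le> t * p x"
  by (auto simp: sublinear_def)

lemma sublinear_zero: "sublinear p \<Longrightarrow> p 0 = 0"
proof -
  assume "sublinear p"
  then have "p (2 *\<^sub>R 0) \<le> 2 * p 0" "p ((1/2) *\<^sub>R 0) \<le> 1/2 * p 0"
    by (intro sublinear_scale_le; simp)+
  then show ?thesis by simp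
qed

lemma sublinear_scale: "sublinear p \<Longrightarrow> 0 \<le> t \<Longrightarrow> p (t *\<^sub>R x) = t * p x"
proof (cases "t = 0")
  case False
  assume p: "sublinear p" and "0 \<le> t"
  with False have t: "t > 0" by simp
  have "p ((1/t) *\<^sub>R (t *\<^sub>R x)) \<le> (1/t) * p (t *\<^sub>R x)" "p (t *\<^sub>R x) \<le> t * p x"
    using p t by (intro sublinear_scale_le; simp)+
  with t show ?thesis by (simp add: field_simps)
qed (simp add: sublinear_zero)

lemma sublinear_lower: "sublinear p \<Longrightarrow> - p (- x) \<le> p x"
proof -
  assume p: "sublinear p"
  then have "p (x + - x) \<le> p x + p (- x)" unfolding sublinear_def by blast
  with sublinear_zero[OF p] show ?thesis by simp
qed

lemma sublinear_INF_chain: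
  assumes ne: "C \<noteq> {}" and sub: "\<And>q. q \<in> C \<Longrightarrow> sublinear q"
    and le: "\<And>q. q \<in> C \<Longrightarrow> q \<le> p"
    and chain: "\<And>q r. q \<in> C \<Longrightarrow> r \<in> C \<Longrightarrow> q \<le> r \<or> r \<le> q"
  shows "sublinear (\<lambda>x. INF q\<in>C. q x)" "\<And>q x. q \<in> C \<Longrightarrow> (INF q\<in>C. q x) \<le> q x"
proof -
  have "- p (- x) \<le> q x" if "q \<in> C" for q x
    using sublinear_lower[OF sub[OF that], of x] le[OF that] by (smt (verit) le_funD)
  then have bdd: "bdd_below ((\<lambda>q. q x) ` C)" for x
    by (intro bdd_belowI2)
  then show lower: "\<And>q x. q \<in> C \<Longrightarrow> (INF q\<in>C. q x) \<le> q x" by (rule cINF_lower)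
  show "sublinear (\<lambda>x. INF q\<in>C. q x)" unfolding sublinear_def
  proof (intro conjI allI impI)
    fix x y
    have *: "(INF q\<in>C. q (x + y)) \<le> q x + r y" if qr: "q \<in> C" "r \<in> C" for q r
    proof -
      from chain[OF qr] obtain s where s: "s \<in> C" "s \<le> q" "s \<le> r" using qr by blast
      have "(INF q\<in>C. q (x + y)) \<le> s (x + y)" by (rule lower[OF s(1)])
      also have "\<dots> \<le> s x + s y" using sub[OF s(1)] by (auto simp: sublinear_def)
      also have "\<dots> \<le> q x + r y" using s by (auto simp: le_fun_def add_mono)
      finally show ?thesis .
    qed
    have "(INF q\<in>C. q (x + y)) - (INF q\<in>C. q y) \<le> q x" if "q \<in> C" for q
    proof -
      have "(INF q\<in>C. q (x + y)) - q x \<le> (INF q\<in>C. q y)"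
        by (rule cINF_greatest[OF ne]) (use *[OF that] in \<open>auto simp: algebra_simps\<close>)
      then show ?thesis by simp
    qed
    then have "(INF q\<in>C. q (x + y)) - (INF q\<in>C. q y) \<le> (INF q\<in>C. q x)"
      by (rule cINF_greatest[OF ne])
    then show "(INF q\<in>C. q (x + y)) \<le> (INF q\<in>C. q x) + (INF q\<in>C. q y)" by simp
  next
    fix t :: real and x assume t: "t > 0"
    have "(INF q\<in>C. q (t *\<^sub>R x)) / t \<le> q x" if "q \<in> C" for q
      using lower[OF that, of "t *\<^sub>R x"] sublinear_scale[OF sub[OF that], of t x] t
      by (simp add: field_simps)
    then have "(INF q\<in>C. q (t *\<^sub>R x)) / t \<le> (INF q\<in>C. q x)" by (rule cINF_greatest[OF ne])
    with t show "(INF q\<in>C. q (t *\<^sub>R x)) \<le> t * (INF q\<in>C. q x)" by (simp add: field_simps)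
  qed
qed

lemma minimal_sublinear_linear:
  assumes q: "sublinear q" and min: "\<And>r. sublinear r \<Longrightarrow> r \<le> q \<Longrightarrow> r = q"
  shows "linear q"
proof -
  have super: "q x + q y \<le> q (x + y)" for x y
  proof -
    let ?r = "\<lambda>x. INF t\<in>{0..}. q (x + t *\<^sub>R y) - t * q y"
    have "- q (- x) \<le> q (x + t *\<^sub>R y) - t * q y" if "t \<ge> 0" for t x
    proof -
      have "q (t *\<^sub>R y) \<le> q (x + t *\<^sub>R y) + q (- x)"
        using sublinear_add[OF q, of "x + t *\<^sub>R y" "- x"] by simp
      with sublinear_scale[OF q that, of y] show ?thesis by simp
    qed
    then have bdd: "bdd_below ((\<lambda>t. q (x + t *\<^sub>R y) - t * q y) ` {0..})" for x
      by (intro bdd_belowI2) auto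
    have lower: "?r x \<le> q (x + t *\<^sub>R y) - t * q y" if "t \<ge> 0" for t x
      by (rule cINF_lower[OF bdd]) (use that in auto)
    have "sublinear ?r" unfolding sublinear_def
    proof (intro conjI allI impI)
      fix u v
      have *: "?r (u + v) \<le> (q (u + s *\<^sub>R y) - s * q y) + (q (v + t *\<^sub>R y) - t * q y)"
        if "s \<ge> 0" "t \<ge> 0" for s t
      proof -
        have "q ((u + s *\<^sub>R y) + (v + t *\<^sub>R y)) \<le> q (u + s *\<^sub>R y) + q (v + t *\<^sub>R y)"
          using q unfolding sublinear_def by blast
        moreover have "(u + s *\<^sub>R y) + (v + t *\<^sub>R y) = (u + v) + (s + t) *\<^sub>R y"
          by (simp add: algebra_simps)
        ultimately show ?thesis using lower[of "s + t" "u + v"] that by (simp add: algebra_simps)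
      qed
      have "?r (u + v) - ?r v \<le> q (u + s *\<^sub>R y) - s * q y" if "s \<in> {0..}" for s
      proof -
        have "?r (u + v) - (q (u + s *\<^sub>R y) - s * q y) \<le> ?r v"
          by (rule cINF_greatest) (use *[of s] that in \<open>auto simp: algebra_simps\<close>)
        then show ?thesis by simp
      qed
      then have "?r (u + v) - ?r v \<le> ?r u" by (intro cINF_greatest) auto
      then show "?r (u + v) \<le> ?r u + ?r v" by simp
    next
      fix s :: real and u assume s: "s > 0"
      have "?r (s *\<^sub>R u) / s \<le> q (u + t *\<^sub>R y) - t * q y" if "t \<in> {0..}" for t
      proof -
        have "?r (s *\<^sub>R u) \<le> q (s *\<^sub>R u + (s * t) *\<^sub>R y) - (s * t) * q y"
          by (rule lower) (use s that in auto)
        also have "s *\<^sub>R u + (s * t) *\<^sub>R y = s *\<^sub>R (u + t *\<^sub>R y)" by (simp add: algebra_simps)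
        also have "q (s *\<^sub>R (u + t *\<^sub>R y)) = s * q (u + t *\<^sub>R y)"
          by (rule sublinear_scale[OF q]) (use s in auto)
        finally show ?thesis using s by (simp add: field_simps)
      qed
      then have "?r (s *\<^sub>R u) / s \<le> ?r u" by (intro cINF_greatest) auto
      with s show "?r (s *\<^sub>R u) \<le> s * ?r u" by (simp add: field_simps)
    qed
    moreover have "?r \<le> q" using lower[of 0] by (auto simp: le_fun_def)
    ultimately have "?r = q" by (rule min)
    then have "?r x = q x" by (rule fun_cong)
    then show ?thesis using lower[of 1 x] by simp
  qed
  have add: "q (x + y) = q x + q y" for x y
    using super[of x y] sublinear_add[OF q, of x y] by simp
  have neg: "q (- x) = - q x" for x
    using add[of x "- x"] sublinear_zero[OF q] by simp
  show ?thesis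
  proof (rule linearI[OF add])
    fix c x
    show "q (c *\<^sub>R x) = c *\<^sub>R q x"
    proof (cases "c \<ge> 0")
      case False
      then have "q ((- c) *\<^sub>R x) = (- c) * q x" by (intro sublinear_scale[OF q]) simp
      with neg[of "c *\<^sub>R x"] show ?thesis by simp
    qed (simp add: sublinear_scale[OF q])
  qed
qed

lemma linear_below_sublinear:
  assumes p: "sublinear p"
  obtains f where "linear f" "\<And>x. f x \<le> p x"
proof -
  let ?S = "{q. sublinear q \<and> q \<le> p}"
  have "\<exists>m\<in>?S. \<forall>q\<in>?S. q \<le> m \<longrightarrow> q = m"
  proof (rule predicate_Zorn)
    show "partial_order_on ?S (relation_of (\<lambda>q r. r \<le> q) ?S)"
      by (rule partial_order_on_relation_ofI) (auto intro: order_trans)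
  next
    fix C assume "C \<in> Chains (relation_of (\<lambda>q r. r \<le> q) ?S)"
    then have C: "\<And>q r. q \<in> C \<Longrightarrow> r \<in> C \<Longrightarrow> q \<le> r \<or> r \<le> q"
        "\<And>q. q \<in> C \<Longrightarrow> sublinear q" "\<And>q. q \<in> C \<Longrightarrow> q \<le> p"
      by (auto simp: Chains_def relation_of_def)
    show "\<exists>u\<in>?S. \<forall>q\<in>C. u \<le> q"
    proof (cases "C = {}")
      case False
      have inf: "sublinear (\<lambda>x. INF q\<in>C. q x)" "\<And>q x. q \<in> C \<Longrightarrow> (INF q\<in>C. q x) \<le> q x"
        using sublinear_INF_chain[of C p] False C by blast+
      from False obtain q where "q \<in> C" by blast
      have le: "(\<lambda>x. INF q\<in>C. q x) \<le> r" if "r \<in> C" for r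
        by (rule le_funI) (rule inf(2)[OF that])
      have "(\<lambda>x. INF q\<in>C. q x) \<le> p" by (rule order_trans[OF le C(3)]) fact+
      with inf(1) le show ?thesis by blast
    qed (use p in auto)
  qed
  then obtain m where m: "sublinear m" "m \<le> p"
    and min: "\<And>q. sublinear q \<Longrightarrow> q \<le> p \<Longrightarrow> q \<le> m \<Longrightarrow> q = m" by blast
  have "linear m" by (rule minimal_sublinear_linear[OF m(1)]) (use m min order_trans in blast)
  then show thesis using that m(2) by (auto simp: le_fun_def)
qed

text \<open>The subgradient is a linear functional below the directional derivative of \<open>F\<close> at \<open>y\<close>,
  which is sublinear.\<close>

lemma subgradient_exists:
  fixes F :: "'b::real_normed_vector \<Rightarrow> real"
  assumes conv: "convex_on UNIV F" and lip: "\<And>x y. \<bar>F x - F y\<bar> \<le> norm (x - y)"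
  obtains f where "bounded_linear f" "\<And>x. \<bar>f x\<bar> \<le> norm x" "\<And>x. F y + f (x - y) \<le> F x"
proof -
  let ?p = "\<lambda>v. INF t\<in>{0<..}. (F (y + t *\<^sub>R v) - F y) / t"
  have bd: "\<bar>(F (y + t *\<^sub>R v) - F y) / t\<bar> \<le> norm v" if "t > 0" for t v
    using lip[of "y + t *\<^sub>R v" y] that by (simp add: field_simps)
  have bdd: "bdd_below ((\<lambda>t. (F (y + t *\<^sub>R v) - F y) / t) ` {0<..})" for v
  proof (rule bdd_belowI2[of _ "- norm v"])
    fix t :: real assume "t \<in> {0<..}"
    then show "- norm v \<le> (F (y + t *\<^sub>R v) - F y) / t" using abs_le_D2[OF bd[of t v]] by simp
  qed
  have lower: "?p v \<le> (F (y + t *\<^sub>R v) - F y) / t" if "t > 0" for t v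
    by (rule cINF_lower[OF bdd]) (use that in auto)
  have "sublinear ?p" unfolding sublinear_def
  proof (intro conjI allI impI)
    fix u v
    have *: "?p (u + v) \<le> (F (y + s *\<^sub>R u) - F y) / s + (F (y + t *\<^sub>R v) - F y) / t"
      if st: "s > 0" "t > 0" for s t
    proof -
      define a where "a = t / (s + t)"
      have a: "0 \<le> a" "a \<le> 1" "1 - a = s / (s + t)" using st by (auto simp: a_def field_simps)
      define r where "r = s * t / (s + t)"
      have r: "r > 0" "a * s = r" "(1 - a) * t = r" using st a by (auto simp: r_def a_def)
      have "F (a *\<^sub>R (y + s *\<^sub>R u) + (1 - a) *\<^sub>R (y + t *\<^sub>R v))
          \<le> a * F (y + s *\<^sub>R u) + (1 - a) * F (y + t *\<^sub>R v)"
        using convex_onD[OF conv, of "1 - a" "y + s *\<^sub>R u" "y + t *\<^sub>R v"] a(1,2) by simp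
      also have "a *\<^sub>R (y + s *\<^sub>R u) + (1 - a) *\<^sub>R (y + t *\<^sub>R v)
          = (a + (1 - a)) *\<^sub>R y + (a * s) *\<^sub>R u + ((1 - a) * t) *\<^sub>R v"
        by (simp add: scaleR_add_right scaleR_left_diff_distrib scaleR_add_left)
      also have "\<dots> = y + r *\<^sub>R (u + v)"
        unfolding r by (simp add: scaleR_add_right add.assoc)
      finally have "F (y + r *\<^sub>R (u + v)) - F y
          \<le> a * (F (y + s *\<^sub>R u) - F y) + (1 - a) * (F (y + t *\<^sub>R v) - F y)"
        by (simp add: algebra_simps)
      then have "(F (y + r *\<^sub>R (u + v)) - F y) / r
          \<le> (a * (F (y + s *\<^sub>R u) - F y) + (1 - a) * (F (y + t *\<^sub>R v) - F y)) / r"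
        using r(1) by (simp add: divide_right_mono)
      also have "\<dots> = a / r * (F (y + s *\<^sub>R u) - F y) + (1 - a) / r * (F (y + t *\<^sub>R v) - F y)"
        by (simp add: add_divide_distrib)
      also have "a / r = 1 / s" using st by (simp add: a_def r_def)
      also have "(1 - a) / r = 1 / t" using st by (simp add: a r_def)
      finally show ?thesis using lower[OF r(1), of "u + v"] by simp
    qed
    have "?p (u + v) - ?p v \<le> (F (y + s *\<^sub>R u) - F y) / s" if "s \<in> {0<..}" for s
    proof -
      have "?p (u + v) - (F (y + s *\<^sub>R u) - F y) / s \<le> ?p v"
        by (rule cINF_greatest) (use *[of s] that in \<open>auto simp: algebra_simps\<close>)
      then show ?thesis by simp
    qed
    then have "?p (u + v) - ?p v \<le> ?p u" by (intro cINF_greatest) auto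
    then show "?p (u + v) \<le> ?p u + ?p v" by simp
  next
    fix s :: real and u assume s: "s > 0"
    have "?p (s *\<^sub>R u) / s \<le> (F (y + t *\<^sub>R u) - F y) / t" if "t \<in> {0<..}" for t
      using lower[of "t / s" "s *\<^sub>R u"] s that by (simp add: field_simps)
    then have "?p (s *\<^sub>R u) / s \<le> ?p u" by (intro cINF_greatest) auto
    with s show "?p (s *\<^sub>R u) \<le> s * ?p u" by (simp add: field_simps)
  qed
  then obtain f where f: "linear f" "\<And>x. f x \<le> ?p x"
    using linear_below_sublinear[of ?p] by blast
  have le: "f x \<le> norm x" for x
    using f(2)[of x] lower[of 1 x] bd[of 1 x] by auto
  have abs: "\<bar>f x\<bar> \<le> norm x" for x
    using le[of x] le[of "- x"] linear_neg[OF f(1), of x] by simp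
  show thesis
  proof (rule that[of f])
    show "bounded_linear f"
      using f(1) abs by (auto simp: bounded_linear_def bounded_linear_axioms_def intro!: exI[of _ 1])
    show "F y + f (x - y) \<le> F x" for x
      using f(2)[of "x - y"] lower[of 1 "x - y"] by simp
  qed (rule abs)
qed

lemma convex_infdist:
  fixes C :: "'b::real_normed_vector set"
  assumes C: "convex C"
  shows "convex_on UNIV (\<lambda>y. infdist y C)"
proof (cases "C = {}")
  case False
  show ?thesis
  proof (rule convex_onI)
    fix t :: real and x y :: 'b assume t: "0 < t" "t < 1"
    show "infdist ((1 - t) *\<^sub>R x + t *\<^sub>R y) C \<le> (1 - t) * infdist x C + t * infdist y C"
    proof (rule field_le_epsilon)
      fix e :: real assume e: "e > 0"
      have near: "\<exists>u\<in>C. dist v u < infdist v C + e" for v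
        using False e cINF_less_iff[of C "dist v" "infdist v C + e"]
        by (auto simp: infdist_def bdd_below_image_dist)
      from near obtain u v where uv: "u \<in> C" "dist x u < infdist x C + e" "v \<in> C" "dist y v < infdist y C + e"
        by meson
      have "infdist ((1 - t) *\<^sub>R x + t *\<^sub>R y) C \<le> dist ((1 - t) *\<^sub>R x + t *\<^sub>R y) ((1 - t) *\<^sub>R u + t *\<^sub>R v)"
        by (rule infdist_le) (use C uv t in \<open>auto simp: convex_alt\<close>)
      also have "(1 - t) *\<^sub>R x + t *\<^sub>R y - ((1 - t) *\<^sub>R u + t *\<^sub>R v) = (1 - t) *\<^sub>R (x - u) + t *\<^sub>R (y - v)"
        by (simp add: algebra_simps)
      then have "dist ((1 - t) *\<^sub>R x + t *\<^sub>R y) ((1 - t) *\<^sub>R u + t *\<^sub>R v) \<le> (1 - t) * dist x u + t * dist y v"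
        unfolding dist_norm using t norm_triangle_ineq[of "(1 - t) *\<^sub>R (x - u)" "t *\<^sub>R (y - v)"] by simp
      also have "\<dots> \<le> (1 - t) * (infdist x C + e) + t * (infdist y C + e)"
        using uv t by (intro add_mono mult_left_mono) auto
      finally show "infdist ((1 - t) *\<^sub>R x + t *\<^sub>R y) C \<le> (1 - t) * infdist x C + t * infdist y C + e"
        by (simp add: algebra_simps)
    qed
  qed simp
qed (simp add: infdist_def convex_on_def)

lemma infdist_weak_lsc:
  fixes C :: "'b::real_normed_vector set"
  assumes C: "convex C"
    and le: "eventually (\<lambda>n. infdist (g n) C \<le> e) sequentially"
    and lim: "\<And>f :: 'b \<Rightarrow> real. bounded_linear f \<Longrightarrow> (\<lambda>n. f (g n)) \<longlonglongrightarrow> f y"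
  shows "infdist y C \<le> e"
proof -
  have lip: "\<bar>infdist u C - infdist v C\<bar> \<le> norm (u - v)" for u v
    using infdist_triangle[of u C v] infdist_triangle[of v C u] by (simp add: dist_norm norm_minus_commute)
  obtain f where f: "bounded_linear f" "\<And>x. \<bar>f x\<bar> \<le> norm x" "\<And>x. infdist y C + f (x - y) \<le> infdist x C"
    by (rule subgradient_exists[OF convex_infdist[OF C] lip, of y]) (rule that)
  have "(\<lambda>n. infdist y C + (f (g n) - f y)) \<longlonglongrightarrow> infdist y C + (f y - f y)"
    by (intro tendsto_intros lim[OF f(1)])
  then have "infdist y C + (f y - f y) \<le> e"
  proof (rule tendsto_upperbound)
    show "eventually (\<lambda>n. infdist y C + (f (g n) - f y) \<le> e) sequentially"
      using le by eventually_elim (use f(3) linear_diff[OF bounded_linear.linear[OF f(1)]] in \<open>smt (verit) order_trans\<close>)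
  qed auto
  then show ?thesis by simp
qed

lemma convergent_geometric_steps:
  fixes x :: "nat \<Rightarrow> 'b::banach"
  assumes "\<And>n. norm (x (Suc n) - x n) \<le> c * (1/2)^n"
  shows "convergent x"
proof -
  have "summable (\<lambda>n. x (Suc n) - x n)"
  proof (rule summable_comparison_test'[of "\<lambda>n. c * (1/2)^n" 0])
    show "summable (\<lambda>n. c * (1 / 2 :: real) ^ n)" by (intro summable_mult summable_geometric) simp
  qed (rule assms)
  then have "(\<lambda>n. x 0 + (\<Sum>i<n. x (Suc i) - x i)) \<longlonglongrightarrow> x 0 + (\<Sum>i. x (Suc i) - x i)"
    by (intro tendsto_intros summable_LIMSEQ)
  then show ?thesis by (auto simp: sum_lessThan_telescope convergent_def)
qed

lemma dense_sequence:
  obtains d :: "nat \<Rightarrow> 'b::{metric_space, second_countable_topology}"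
  where "\<And>y e. 0 < e \<Longrightarrow> \<exists>i. dist (d i) y < e"
proof -
  obtain D :: "'b set" where D: "countable D" "\<And>X. open X \<Longrightarrow> X \<noteq> {} \<Longrightarrow> \<exists>d\<in>D. d \<in> X"
    using countable_dense_exists by blast
  have ne: "D \<noteq> {}" using D(2)[of UNIV] by auto
  show thesis
  proof (rule that[of "from_nat_into D"])
    fix y :: 'b and e :: real assume "0 < e"
    then obtain d where "d \<in> D" "d \<in> ball y e" using D(2)[of "ball y e"] by auto
    then show "\<exists>i. dist (from_nat_into D i) y < e"
      by (metis D(1) dist_commute from_nat_into_surj mem_ball)
  qed
qed

definition norming :: "(nat \<Rightarrow> 'b::real_normed_vector \<Rightarrow> real) \<Rightarrow> bool" where
  "norming ys \<longleftrightarrow> (\<forall>j. bounded_linear (ys j)) \<and> (\<forall>j x. \<bar>ys j x\<bar> \<le> norm x) \<and>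
     (\<forall>x r. (\<forall>j. ys j x \<le> r) \<longrightarrow> norm x \<le> r)"

lemma norming_exists:
  "\<exists>ys :: nat \<Rightarrow> 'b::{real_normed_vector, second_countable_topology} \<Rightarrow> real. norming ys"
proof -
  obtain d :: "nat \<Rightarrow> 'b" where d: "\<And>y e. 0 < e \<Longrightarrow> \<exists>i. dist (d i) y < e"
    using dense_sequence by blast
  have "\<exists>f. bounded_linear f \<and> (\<forall>x. \<bar>f x\<bar> \<le> norm x) \<and> norm (d j) \<le> f (d j)" for j
  proof -
    obtain f where f: "bounded_linear f" "\<And>x. \<bar>f x\<bar> \<le> norm x" "\<And>x. norm (d j) + f (x - d j) \<le> norm x"
      using subgradient_exists[of norm "d j"] convex_infdist[of "{0 :: 'b}", unfolded infdist_singleton dist_norm diff_0_right] norm_triangle_ineq3 by blast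
    from f(3)[of 0] have "norm (d j) \<le> f (d j)"
      using linear_neg[OF bounded_linear.linear[OF f(1)], of "d j"] by simp
    with f show ?thesis by blast
  qed
  then obtain ys where ys: "\<And>j. bounded_linear (ys j)" "\<And>j x. \<bar>ys j x\<bar> \<le> norm x"
      "\<And>j. norm (d j) \<le> ys j (d j)" by metis
  have "norm x \<le> r" if r: "\<forall>j. ys j x \<le> r" for x r
  proof (rule field_le_epsilon)
    fix e :: real assume "e > 0"
    then obtain j where j: "dist (d j) x < e / 2" using d[of "e/2" x] by auto
    have "norm x \<le> norm (d j) + norm (x - d j)" using norm_triangle_sub by blast
    also have "norm (d j) \<le> ys j (d j)" by (rule ys)
    also have "ys j (d j) = ys j x + ys j (d j - x)"
      using linear_diff[OF bounded_linear.linear[OF ys(1)]] by simp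
    also have "\<dots> \<le> r + norm (d j - x)" using r ys(2)[of j "d j - x"] by (intro add_mono) auto
    finally show "norm x \<le> r + e" using j by (simp add: dist_norm norm_minus_commute)
  qed
  with ys show ?thesis unfolding norming_def by blast
qed

lemma norming_diff: "norming ys \<Longrightarrow> ys j (x - y) = ys j x - ys j y"
  by (simp add: norming_def bounded_linear.linear linear_diff)

lemma norming_bound: "norming ys \<Longrightarrow> \<bar>ys j x\<bar> \<le> norm x"
  by (simp add: norming_def)

lemma norming_least: "norming ys \<Longrightarrow> (\<And>j. ys j x \<le> r) \<Longrightarrow> norm x \<le> r"
  by (simp add: norming_def)

lemma norming_eq: "norming ys \<Longrightarrow> (\<And>j. ys j x = ys j y) \<Longrightarrow> x = y"
proof -
  assume ys: "norming ys" and eq: "\<And>j. ys j x = ys j y"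
  then have "norm (x - y) \<le> 0" by (intro norming_least) (auto simp: norming_diff)
  then show ?thesis by simp
qed

section \<open>Measurable selections\<close>

text \<open>Kuratowski--Ryll-Nardzewski: the selection is the uniform limit of functions with values in a
  dense sequence, the \<open>n\<close>-th of which stays within \<open>(1/2)^n\<close> of \<open>T\<close>.\<close>

lemma measurable_selection:
  fixes T :: "'a \<Rightarrow> 'b::{banach, second_countable_topology} set"
  assumes T: "lower_measurable M T" and ne: "\<And>\<omega>. \<omega> \<in> space M \<Longrightarrow> T \<omega> \<noteq> {}"
  obtains s where "s \<in> borel_measurable M" "\<And>\<omega>. \<omega> \<in> space M \<Longrightarrow> s \<omega> \<in> closure (T \<omega>)"
proof -
  obtain d :: "nat \<Rightarrow> 'b" where d: "\<And>y e. 0 < e \<Longrightarrow> \<exists>i. dist (d i) y < e"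
    using dense_sequence by blast
  define hit where "hit n i \<omega> \<longleftrightarrow> T \<omega> \<inter> ball (d i) ((1/2)^n) \<noteq> {}" for n i \<omega>
  have hit_meas [measurable]: "Measurable.pred M (hit n i)" for n i
    using T unfolding lower_measurable_def hit_def pred_def by auto
  define N where "N = rec_nat (\<lambda>\<omega>. LEAST i. hit 0 i \<omega>)
    (\<lambda>n k \<omega>. LEAST i. hit (Suc n) i \<omega> \<and> dist (d i) (d (k \<omega>)) < 2 * (1/2)^n)"
  have N0: "N 0 = (\<lambda>\<omega>. LEAST i. hit 0 i \<omega>)"
    and NS: "N (Suc n) = (\<lambda>\<omega>. LEAST i. hit (Suc n) i \<omega> \<and> dist (d i) (d (N n \<omega>)) < 2 * (1/2)^n)" for n
    by (simp_all add: N_def)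
  have N_meas [measurable]: "N n \<in> measurable M (count_space UNIV)" for n
  proof (induction n)
    case 0
    show ?case unfolding N0 by measurable
  next
    case (Suc n)
    note Suc[measurable]
    show ?case unfolding NS by measurable
  qed
  have near: "\<exists>i. hit n i \<omega> \<and> dist (d i) y < (1/2)^n" if "y \<in> T \<omega>" for n \<omega> y
  proof -
    obtain i where "dist (d i) y < (1/2)^n" using d[of "(1/2)^n" y] by auto
    with that show ?thesis unfolding hit_def by (intro exI[of _ i]) auto
  qed
  have hitN: "hit n (N n \<omega>) \<omega>" and step: "dist (d (N (Suc n) \<omega>)) (d (N n \<omega>)) < 2 * (1/2)^n"
    if \<omega>: "\<omega> \<in> space M" for n \<omega>
  proof -
    have ex: "\<exists>i. hit (Suc n) i \<omega> \<and> dist (d i) (d (N n \<omega>)) < 2 * (1/2)^n" if h: "hit n (N n \<omega>) \<omega>" for n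
    proof -
      obtain y where y: "y \<in> T \<omega>" "dist (d (N n \<omega>)) y < (1/2)^n" using h unfolding hit_def by auto
      obtain i where i: "hit (Suc n) i \<omega>" "dist (d i) y < (1/2)^(Suc n)" using near[OF y(1)] by blast
      have "dist (d i) (d (N n \<omega>)) \<le> dist (d i) y + dist (d (N n \<omega>)) y" by (rule dist_triangle2)
      also have "\<dots> < (1/2)^(Suc n) + (1/2)^n" using i y by simp
      also have "\<dots> \<le> 2 * (1/2)^n" by simp
      finally show ?thesis using i by blast
    qed
    have "\<exists>i. hit 0 i \<omega>" using ne[OF \<omega>] near by blast
    then have h0: "hit 0 (N 0 \<omega>) \<omega>" unfolding N0 by (rule LeastI_ex)
    have h: "hit n (N n \<omega>) \<omega>" for n
    proof (induction n)
      case (Suc n)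
      from LeastI_ex[OF ex[OF Suc]] show ?case unfolding NS by blast
    qed (rule h0)
    show "hit n (N n \<omega>) \<omega>" by (rule h)
    from LeastI_ex[OF ex[OF h[of n]]] show "dist (d (N (Suc n) \<omega>)) (d (N n \<omega>)) < 2 * (1/2)^n"
      unfolding NS by blast
  qed
  have conv: "\<exists>s. (\<lambda>n. d (N n \<omega>)) \<longlonglongrightarrow> s" if \<omega>: "\<omega> \<in> space M" for \<omega>
  proof -
    have "norm (d (N (Suc n) \<omega>) - d (N n \<omega>)) \<le> 2 * (1/2)^n" for n
      using step[OF \<omega>, of n] by (simp add: dist_norm)
    then have "convergent (\<lambda>n. d (N n \<omega>))" by (rule convergent_geometric_steps)
    then show ?thesis unfolding convergent_def .
  qed
  then obtain s where s: "\<And>\<omega>. \<omega> \<in> space M \<Longrightarrow> (\<lambda>n. d (N n \<omega>)) \<longlonglongrightarrow> s \<omega>" by metis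
  show thesis
  proof
    show "s \<in> borel_measurable M"
      by (rule borel_measurable_LIMSEQ_metric[OF _ s]) measurable
    fix \<omega> assume \<omega>: "\<omega> \<in> space M"
    have "\<exists>y\<in>T \<omega>. dist y (s \<omega>) < e" if "e > 0" for e
    proof -
      have "eventually (\<lambda>n. dist (d (N n \<omega>)) (s \<omega>) < e / 2) sequentially"
        using tendstoD[OF s[OF \<omega>], of "e/2"] that by simp
      moreover have "eventually (\<lambda>n. (1/2::real)^n < e / 2) sequentially"
        using order_tendstoD(2)[OF LIMSEQ_realpow_zero[of "1/2"], of "e/2"] that by simp
      ultimately have "eventually (\<lambda>n. dist (d (N n \<omega>)) (s \<omega>) < e / 2 \<and> (1/2::real)^n < e / 2) sequentially"
        by (rule eventually_conj)
      then obtain n where n: "dist (d (N n \<omega>)) (s \<omega>) < e / 2" "(1/2::real)^n < e / 2"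
        using eventually_happens by force
      obtain y where y: "y \<in> T \<omega>" "dist (d (N n \<omega>)) y < (1/2)^n" using hitN[OF \<omega>, of n] unfolding hit_def by auto
      have "dist y (s \<omega>) < e"
        using dist_triangle[of y "s \<omega>" "d (N n \<omega>)"] n y by (simp add: dist_commute)
      with y show ?thesis by blast
    qed
    then show "s \<omega> \<in> closure (T \<omega>)" by (auto simp: closure_approachable)
  qed
qed

section \<open>Weakly compact sets\<close>

lemma compactin_embedding_nhd:
  fixes e :: "'x \<Rightarrow> 'y::t2_space"
  assumes K: "compactin T K" and cont: "continuous_map T euclidean e" and inj: "inj_on e K"
    and U: "openin T U" "x \<in> U" "x \<in> K"
  obtains W where "open W" "e x \<in> W" "\<And>y. y \<in> K \<Longrightarrow> e y \<in> W \<Longrightarrow> y \<in> U"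
proof -
  have "compactin T (K \<inter> (topspace T - U))"
    by (rule compact_Int_closedin[OF K]) (use U in auto)
  then have "closed (e ` (K \<inter> (topspace T - U)))"
    using image_compactin[OF _ cont] compact_imp_closed by auto
  moreover have "e x \<notin> e ` (K \<inter> (topspace T - U))"
    using inj U by (auto simp: inj_on_def)
  moreover have "y \<in> U" if "y \<in> K" "e y \<notin> e ` (K \<inter> (topspace T - U))" for y
    using that compactin_subset_topspace[OF K] by auto
  ultimately show thesis
    by (intro that[of "- e ` (K \<inter> (topspace T - U))"]) (auto simp: open_Compl)
qed

lemma continuous_map_sequence:
  fixes e :: "'x \<Rightarrow> nat \<Rightarrow> real"
  assumes "\<And>k. continuous_map T euclidean (\<lambda>x. e x k)"
  shows "continuous_map T euclidean e"
  using assms by (simp add: continuous_map_componentwise_UNIV flip: euclidean_product_topology)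

lemma topspace_weak_topology_on: "x \<in> topspace (weak_topology_on D \<Phi>) \<Longrightarrow> x \<in> D"
  unfolding weak_topology_on_def topology_generated_by_topspace by auto

lemma openin_weak_topology_on: "\<phi> \<in> \<Phi> \<Longrightarrow> open U \<Longrightarrow> openin (weak_topology_on D \<Phi>) {x \<in> D. \<phi> x \<in> U}"
  unfolding weak_topology_on_def by (intro topology_generated_by_Basis) auto

lemma continuous_map_weak_topology_on:
  assumes "\<phi> \<in> \<Phi>"
  shows "continuous_map (weak_topology_on D \<Phi>) euclidean \<phi>"
  unfolding continuous_map_def
proof safe
  fix U :: "real set" assume "openin euclidean U"
  then have "openin (weak_topology_on D \<Phi>) {x \<in> D. \<phi> x \<in> U}"
    using assms by (intro openin_weak_topology_on) auto
  moreover have "{x \<in> D. \<phi> x \<in> U} = {x \<in> topspace (weak_topology_on D \<Phi>). \<phi> x \<in> U}"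
    using topspace_weak_topology_on[of _ D \<Phi>] openin_subset[OF calculation] by auto
  ultimately show "openin (weak_topology_on D \<Phi>) {x \<in> topspace (weak_topology_on D \<Phi>). \<phi> x \<in> U}" by simp
qed auto

lemma weak_compact_limit:
  fixes K :: "'b::real_normed_vector set"
  assumes K: "compactin weak_topology K" and ys: "norming ys"
    and y: "\<And>n. y n \<in> K" and conv: "\<And>j. (\<lambda>n. ys j (y n)) \<longlonglongrightarrow> l j"
  obtains x where "x \<in> K" "\<And>j. ys j x = l j" "\<And>f. bounded_linear f \<Longrightarrow> (\<lambda>n. f (y n) :: real) \<longlonglongrightarrow> f x"
proof -
  define e where "e v = (\<lambda>j. ys j v)" for v
  have cont: "continuous_map weak_topology euclidean e"
    unfolding weak_topology_def e_def
    by (intro continuous_map_sequence continuous_map_weak_topology_on) (use ys in \<open>auto simp: norming_def\<close>)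
  have inj: "inj_on e K"
    by (rule inj_onI) (use norming_eq[OF ys] in \<open>auto simp: e_def fun_eq_iff\<close>)
  have lim: "(\<lambda>n. e (y n)) \<longlonglongrightarrow> l"
    using conv by (simp add: e_def limitin_componentwise flip: limitin_canonical_iff euclidean_product_topology)
  have "closed (e ` K)" using image_compactin[OF K cont] compact_imp_closed by auto
  then have "l \<in> e ` K" by (rule closed_sequentially[OF _ _ lim]) (use y in auto)
  then obtain x where x: "x \<in> K" "e x = l" by auto
  show thesis
  proof (rule that[OF x(1)])
    show "ys j x = l j" for j using x by (auto simp: e_def)
    fix f :: "'b \<Rightarrow> real" assume f: "bounded_linear f"
    show "(\<lambda>n. f (y n)) \<longlonglongrightarrow> f x"
    proof (rule topological_tendstoI)
      fix U assume U: "open U" "f x \<in> U"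
      have "openin weak_topology {v \<in> UNIV. f v \<in> U}"
        unfolding weak_topology_def by (rule openin_weak_topology_on) (use f U in auto)
      then obtain W where W: "open W" "e x \<in> W" "\<And>v. v \<in> K \<Longrightarrow> e v \<in> W \<Longrightarrow> v \<in> {v \<in> UNIV. f v \<in> U}"
        by (rule compactin_embedding_nhd[OF K cont inj, of _ x]) (use x U in auto)
      have "eventually (\<lambda>n. e (y n) \<in> W) sequentially"
        using topological_tendstoD[OF lim W(1)] W(2) x by simp
      then show "eventually (\<lambda>n. f (y n) \<in> U) sequentially"
        by eventually_elim (use W(3) y in auto)
    qed
  qed
qed

lemma weak_compact_closed:
  fixes K :: "'b::{real_normed_vector, second_countable_topology} set"
  assumes K: "compactin weak_topology K"
  shows "closed K"
proof -
  obtain ys :: "nat \<Rightarrow> 'b \<Rightarrow> real" where ys: "norming ys" using norming_exists by blast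
  show ?thesis unfolding closed_sequential_limits
  proof safe
    fix y l assume y: "\<forall>n. y n \<in> K" "y \<longlonglongrightarrow> l"
    have lim: "(\<lambda>n. ys j (y n)) \<longlonglongrightarrow> ys j l" for j
      using ys bounded_linear.tendsto[OF _ y(2)] by (auto simp: norming_def)
    obtain x where x: "x \<in> K" "\<And>j. ys j x = ys j l"
      using weak_compact_limit[OF K ys _ lim] y(1) by metis
    then show "l \<in> K" using norming_eq[OF ys, of x l] by simp
  qed
qed

lemma weakly_measurable_imp_measurable:
  fixes g :: "'a \<Rightarrow> 'b::{real_normed_vector, second_countable_topology}"
  assumes ys: "norming ys" and meas: "\<And>j. (\<lambda>\<omega>. ys j (g \<omega>)) \<in> borel_measurable M"
  shows "g \<in> borel_measurable M"
proof -
  obtain d :: "nat \<Rightarrow> 'b" where d: "\<And>y e. 0 < e \<Longrightarrow> \<exists>i. dist (d i) y < e"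
    using dense_sequence by blast
  have dist_meas [measurable]: "(\<lambda>\<omega>. dist (d i) (g \<omega>)) \<in> borel_measurable M" for i
  proof (rule borel_measurableI_le)
    fix r
    have iff: "dist (d i) v \<le> r \<longleftrightarrow> (\<forall>j. ys j v - ys j (d i) \<le> r)" for v
    proof -
      have diff: "ys j v - ys j (d i) = ys j (v - d i)" for j
        using norming_diff[OF ys] by simp
      show ?thesis
      proof
        assume "dist (d i) v \<le> r"
        then show "\<forall>j. ys j v - ys j (d i) \<le> r"
          using norming_bound[OF ys, of _ "v - d i"] unfolding diff dist_norm
          by (metis abs_le_D1 norm_minus_commute order_trans)
      next
        assume "\<forall>j. ys j v - ys j (d i) \<le> r"
        then have "norm (v - d i) \<le> r" unfolding diff by (intro norming_least[OF ys]) simp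
        then show "dist (d i) v \<le> r" by (simp add: dist_norm norm_minus_commute)
      qed
    qed
    note meas[measurable]
    show "{\<omega> \<in> space M. dist (d i) (g \<omega>) \<le> r} \<in> sets M" unfolding iff by measurable
  qed
  show ?thesis
  proof (rule borel_measurableI)
    fix S :: "'b set" assume S: "open S"
    have "g \<omega> \<in> S \<longleftrightarrow> (\<exists>i n. ball (d i) (1 / Suc n) \<subseteq> S \<and> dist (d i) (g \<omega>) < 1 / Suc n)" for \<omega>
    proof
      assume "g \<omega> \<in> S"
      then obtain e where e: "e > 0" "ball (g \<omega>) e \<subseteq> S" using S by (auto simp: open_contains_ball)
      then obtain n where n: "1 / Suc n < e / 2" using nat_approx_posE[of "e/2"] by auto
      obtain i where i: "dist (d i) (g \<omega>) < 1 / Suc n" using d[of "1 / Suc n"] by auto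
      have "ball (d i) (1 / Suc n) \<subseteq> ball (g \<omega>) e"
      proof
        fix v assume "v \<in> ball (d i) (1 / Suc n)"
        then show "v \<in> ball (g \<omega>) e"
          using dist_triangle[of "g \<omega>" v "d i"] i n by (simp add: dist_commute)
      qed
      then show "\<exists>i n. ball (d i) (1 / Suc n) \<subseteq> S \<and> dist (d i) (g \<omega>) < 1 / Suc n" using e i by blast
    next
      assume "\<exists>i n. ball (d i) (1 / Suc n) \<subseteq> S \<and> dist (d i) (g \<omega>) < 1 / Suc n"
      then obtain i n where "ball (d i) (1 / Suc n) \<subseteq> S" "dist (d i) (g \<omega>) < 1 / Suc n" by blast
      then show "g \<omega> \<in> S" by (meson mem_ball subsetD)
    qed
    then have "g -` S \<inter> space M = {\<omega> \<in> space M. \<exists>i n. ball (d i) (1 / Suc n) \<subseteq> S \<and> dist (d i) (g \<omega>) < 1 / Suc n}"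
      by auto
    also have "\<dots> \<in> sets M" by measurable
    finally show "g -` S \<inter> space M \<in> sets M" .
  qed
qed

lemma AE_bounded_if_summable_integral:
  fixes D :: "nat \<Rightarrow> 'a \<Rightarrow> real"
  assumes int: "\<And>k. integrable M (D k)" and nonneg: "\<And>k \<omega>. 0 \<le> D k \<omega>"
    and sum: "summable (\<lambda>k. LINT \<omega>|M. D k \<omega>)"
  shows "AE \<omega> in M. \<exists>C. \<forall>k. D k \<omega> \<le> C"
proof -
  have [measurable]: "D k \<in> borel_measurable M" for k using int by auto
  have "(\<integral>\<^sup>+\<omega>. (\<Sum>k. ennreal (D k \<omega>)) \<partial>M) = (\<Sum>k. \<integral>\<^sup>+\<omega>. ennreal (D k \<omega>) \<partial>M)"
    by (rule nn_integral_suminf) measurable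
  also have "\<dots> = (\<Sum>k. ennreal (LINT \<omega>|M. D k \<omega>))"
    using int nonneg by (intro suminf_cong nn_integral_eq_integral) auto
  also have "\<dots> \<noteq> \<infinity>"
    unfolding infinity_ennreal_def by (rule ennreal_suminf_neq_top[OF sum]) (simp add: nonneg)
  finally have "(\<integral>\<^sup>+\<omega>. (\<Sum>k. ennreal (D k \<omega>)) \<partial>M) \<noteq> \<infinity>" .
  then have "AE \<omega> in M. (\<Sum>k. ennreal (D k \<omega>)) \<noteq> \<infinity>"
    by (intro nn_integral_noteq_infinite) measurable
  then show ?thesis
  proof eventually_elim
    fix \<omega> assume fin: "(\<Sum>k. ennreal (D k \<omega>)) \<noteq> \<infinity>"
    have "D k \<omega> \<le> enn2real (\<Sum>k. ennreal (D k \<omega>))" for k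
    proof -
      have "sum (\<lambda>k. ennreal (D k \<omega>)) {k} \<le> (\<Sum>k. ennreal (D k \<omega>))"
        by (rule sum_le_suminf) auto
      then have "enn2real (ennreal (D k \<omega>)) \<le> enn2real (\<Sum>k. ennreal (D k \<omega>))"
        using fin by (intro enn2real_mono) (simp_all add: less_top)
      then show ?thesis using nonneg by simp
    qed
    then show "\<exists>C. \<forall>k. D k \<omega> \<le> C" by blast
  qed
qed

section \<open>Forward midpoint combinations of selections\<close>

inductive_set mid_hull :: "(nat \<Rightarrow> 'a \<Rightarrow> 'b::real_vector) \<Rightarrow> nat \<Rightarrow> ('a \<Rightarrow> 'b) set"
  for f :: "nat \<Rightarrow> 'a \<Rightarrow> 'b" and n :: nat where
  base: "n \<le> k \<Longrightarrow> f k \<in> mid_hull f n"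
| mid: "g \<in> mid_hull f n \<Longrightarrow> g' \<in> mid_hull f n \<Longrightarrow> (\<lambda>\<omega>. (1/2) *\<^sub>R (g \<omega> + g' \<omega>)) \<in> mid_hull f n"

lemma mid_hull_mono: "n \<le> n' \<Longrightarrow> mid_hull f n' \<subseteq> mid_hull f n"
proof
  fix g assume "n \<le> n'" "g \<in> mid_hull f n'"
  from this(2,1) show "g \<in> mid_hull f n"
    by (induction rule: mid_hull.induct) (auto intro: mid_hull.intros)
qed

lemma mid_hull_convex:
  assumes "g \<in> mid_hull f n" "convex C" "\<And>k. n \<le> k \<Longrightarrow> f k \<omega> \<in> C"
  shows "g \<omega> \<in> C"
  using assms(1)
proof (induction rule: mid_hull.induct)
  case (mid g g')
  then have "(1/2) *\<^sub>R g \<omega> + (1/2) *\<^sub>R g' \<omega> \<in> C" using assms(2) by (intro convexD) auto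
  then show ?case by (simp add: scaleR_add_right)
qed (use assms in auto)

definition quad :: "(nat \<Rightarrow> 'b::real_normed_vector \<Rightarrow> real) \<Rightarrow> 'b \<Rightarrow> real" where
  "quad ys y = (\<Sum>j. (1/2)^j * (ys j y)\<^sup>2)"

context
  fixes ys :: "nat \<Rightarrow> 'b::real_normed_vector \<Rightarrow> real"
  assumes ys: "norming ys"
begin

lemma quad_term_le: "(1/2)^j * (ys j y)\<^sup>2 \<le> (1/2)^j * (norm y)\<^sup>2"
  using norming_bound[OF ys, of j y] by (intro mult_left_mono) (simp_all add: abs_le_square_iff[symmetric])

lemma quad_summable: "summable (\<lambda>j. (1/2)^j * (ys j y)\<^sup>2)"
proof (rule summable_comparison_test'[of "\<lambda>j. (1/2)^j * (norm y)\<^sup>2" 0])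
  show "summable (\<lambda>j. (1 / 2 :: real)^j * (norm y)\<^sup>2)" by (intro summable_mult2 summable_geometric) simp
qed (use quad_term_le in simp)

lemma quad_nonneg: "0 \<le> quad ys y"
  unfolding quad_def by (rule suminf_nonneg[OF quad_summable]) simp

lemma quad_ge: "(1/2)^j * (ys j y)\<^sup>2 \<le> quad ys y"
  unfolding quad_def using sum_le_suminf[OF quad_summable, of "{j}" y] by simp

lemma quad_le: "quad ys y \<le> 2 * (norm y)\<^sup>2"
proof -
  have "quad ys y \<le> (\<Sum>j. (1/2)^j * (norm y)\<^sup>2)"
    unfolding quad_def
    by (intro suminf_le quad_summable quad_term_le summable_mult2 summable_geometric) simp
  also have "\<dots> = (\<Sum>j. (1/2)^j) * (norm y)\<^sup>2"
    by (rule suminf_mult2[symmetric]) (simp add: summable_geometric)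
  also have "(\<Sum>j. (1/2::real)^j) = 2" using suminf_geometric[of "1/2::real"] by simp
  finally show ?thesis .
qed

lemma quad_parallelogram:
  "quad ys ((1/2) *\<^sub>R (x + y)) + quad ys ((1/2) *\<^sub>R (x - y)) = (quad ys x + quad ys y) / 2"
proof -
  have lin: "ys j ((1/2) *\<^sub>R (x + y)) = (ys j x + ys j y) / 2" "ys j ((1/2) *\<^sub>R (x - y)) = (ys j x - ys j y) / 2" for j
    using ys by (simp_all add: norming_def bounded_linear.linear linear_diff linear_add linear_cmul)
  have "quad ys ((1/2) *\<^sub>R (x + y)) + quad ys ((1/2) *\<^sub>R (x - y))
      = (\<Sum>j. (1/2)^j * (ys j ((1/2) *\<^sub>R (x + y)))\<^sup>2 + (1/2)^j * (ys j ((1/2) *\<^sub>R (x - y)))\<^sup>2)"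
    unfolding quad_def by (intro suminf_add quad_summable)
  also have "\<dots> = (\<Sum>j. ((1/2)^j * (ys j x)\<^sup>2 + (1/2)^j * (ys j y)\<^sup>2) * (1/2))"
    unfolding lin by (rule arg_cong[of _ _ suminf]) (auto simp: fun_eq_iff power2_eq_square field_simps)
  also have "\<dots> = (quad ys x + quad ys y) * (1/2)"
    unfolding quad_def by (subst suminf_mult2[symmetric]) (intro summable_add quad_summable, simp add: suminf_add quad_summable)
  finally show ?thesis by simp
qed

end

locale wc_correspondence = finite_measure M
  for M :: "'a measure" +
  fixes K :: "'a \<Rightarrow> 'b::{banach, second_countable_topology} set" and h :: "'a \<Rightarrow> real"
  assumes K_convex: "\<And>\<omega>. \<omega> \<in> space M \<Longrightarrow> convex (K \<omega>)"
    and K_compact: "\<And>\<omega>. \<omega> \<in> space M \<Longrightarrow> compactin weak_topology (K \<omega>)"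
    and h: "integrable M h" "\<And>\<omega>. 0 \<le> h \<omega>"
    and K_bound: "AE \<omega> in M. \<forall>y\<in>K \<omega>. norm y \<le> h \<omega>"
begin

definition sel :: "('a \<Rightarrow> 'b) set" where
  "sel = {f \<in> borel_measurable M. AE \<omega> in M. f \<omega> \<in> K \<omega>}"

lemma sel_measurable [measurable_dest]: "f \<in> sel \<Longrightarrow> f \<in> borel_measurable M"
  and sel_in: "f \<in> sel \<Longrightarrow> AE \<omega> in M. f \<omega> \<in> K \<omega>"
  by (auto simp: sel_def)

lemma sel_bound: "f \<in> sel \<Longrightarrow> AE \<omega> in M. norm (f \<omega>) \<le> h \<omega>"
  using sel_in[of f] K_bound by (auto elim: eventually_elim2)

lemma sel_integrable: "f \<in> sel \<Longrightarrow> integrable M f"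
  by (rule Bochner_Integration.integrable_bound[OF h(1)])
     (use sel_bound[of f] h(2) in \<open>auto simp: sel_measurable\<close>)

lemma mid_hull_sel:
  assumes "\<And>k. f k \<in> sel" "g \<in> mid_hull f n"
  shows "g \<in> sel"
proof -
  from assms(2) have "g \<in> borel_measurable M"
    by (induction rule: mid_hull.induct) (use assms(1) in \<open>auto simp: sel_def\<close>)
  moreover have "AE \<omega> in M. \<forall>k. f k \<omega> \<in> K \<omega>"
    unfolding AE_all_countable using sel_in[OF assms(1)] by blast
  then have "AE \<omega> in M. g \<omega> \<in> K \<omega>"
    using AE_space by eventually_elim (use mid_hull_convex[OF assms(2) K_convex] in auto)
  ultimately show ?thesis by (simp add: sel_def)
qed

text \<open>Forward midpoint combinations nearly minimizing a quadratic form are Cauchy for it by the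
  parallelogram law; after passing to a subsequence this gives convergence almost everywhere.\<close>

lemma mid_hull_weakly_convergent:
  assumes f: "\<And>k. f k \<in> sel"
  obtains g G where "g \<in> sel" "\<And>k. G k \<in> mid_hull f k"
    "AE \<omega> in M. \<forall>\<phi>. bounded_linear \<phi> \<longrightarrow> (\<lambda>k. \<phi> (G k \<omega>) :: real) \<longlonglongrightarrow> \<phi> (g \<omega>)"
proof -
  obtain ys :: "nat \<Rightarrow> 'b \<Rightarrow> real" where ys: "norming ys" using norming_exists by blast
  have ys_meas: "(\<lambda>\<omega>. ys j (g \<omega>)) \<in> borel_measurable M" if "g \<in> borel_measurable M" for j g
    using ys that by (auto simp: norming_def intro!: borel_measurable_continuous_on[of _ g] linear_continuous_on)
  define D where "D g \<omega> = quad ys (g \<omega>) / (1 + h \<omega>)" for g \<omega>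
  define J where "J g = (LINT \<omega>|M. D g \<omega>)" for g
  have D_nonneg: "0 \<le> D g \<omega>" for g \<omega>
    using quad_nonneg[OF ys] h(2) by (simp add: D_def add_nonneg_nonneg)
  have D_int: "integrable M (D g)" and J_le: "J g \<le> (LINT \<omega>|M. 2 * h \<omega>)"
    if [measurable]: "g \<in> borel_measurable M" and bd: "AE \<omega> in M. norm (g \<omega>) \<le> h \<omega>" for g
  proof -
    have le: "AE \<omega> in M. D g \<omega> \<le> 2 * h \<omega>" using bd
    proof eventually_elim
      fix \<omega> assume n: "norm (g \<omega>) \<le> h \<omega>"
      have "quad ys (g \<omega>) \<le> 2 * (norm (g \<omega>))\<^sup>2" by (rule quad_le[OF ys])
      also have "\<dots> \<le> 2 * (h \<omega>)\<^sup>2" using n by (simp add: power_mono)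
      also have "\<dots> \<le> 2 * h \<omega> * (1 + h \<omega>)" using h(2)[of \<omega>] by (simp add: power2_eq_square algebra_simps)
      finally show "D g \<omega> \<le> 2 * h \<omega>" using h(2)[of \<omega>] by (simp add: D_def divide_le_eq)
    qed
    have [measurable]: "h \<in> borel_measurable M" using h(1) by auto
    have "D g \<in> borel_measurable M"
      unfolding D_def[abs_def] quad_def using ys_meas[OF that(1)] by measurable
    then show "integrable M (D g)"
      by (rule Bochner_Integration.integrable_bound[of M "\<lambda>\<omega>. 2 * h \<omega>", rotated])
         (use le h D_nonneg in auto)
    then show "J g \<le> (LINT \<omega>|M. 2 * h \<omega>)"
      unfolding J_def using le h(1) by (intro integral_mono_AE) auto
  qed
  have D_sel: "integrable M (D g)" "J g \<le> (LINT \<omega>|M. 2 * h \<omega>)" if "g \<in> mid_hull f n" for g n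
    using D_int[OF _ sel_bound] J_le[OF _ sel_bound] mid_hull_sel[OF f that] sel_measurable by auto
  have J_nonneg: "0 \<le> J g" for g unfolding J_def by (rule Bochner_Integration.integral_nonneg[OF D_nonneg])
  define \<mu> where "\<mu> n = (INF g\<in>mid_hull f n. J g)" for n
  have bdd: "bdd_below (J ` S)" for S by (rule bdd_belowI2[of _ 0]) (rule J_nonneg)
  have ne: "mid_hull f n \<noteq> {}" for n using mid_hull.base[of n n f] by auto
  have \<mu>_le: "\<mu> n \<le> J g" if "g \<in> mid_hull f n" for n g
    unfolding \<mu>_def by (rule cINF_lower[OF bdd that])
  have "incseq \<mu>"
    unfolding \<mu>_def by (intro monoI cINF_superset_mono ne bdd mid_hull_mono) auto
  moreover have "\<mu> n \<le> (LINT \<omega>|M. 2 * h \<omega>)" for n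
    using \<mu>_le D_sel(2) mid_hull.base[of n n f] by (meson order_refl order_trans)
  ultimately obtain L where L: "\<mu> \<longlonglongrightarrow> L" "\<And>n. \<mu> n \<le> L"
    using incseq_convergent[of \<mu> "LINT \<omega>|M. 2 * h \<omega>"] by metis
  have "\<exists>N. \<forall>n\<ge>N. L - \<mu> n < (1/8)^k" for k
  proof -
    have "eventually (\<lambda>n. L - (1/8)^k < \<mu> n) sequentially" by (rule order_tendstoD(1)[OF L(1)]) simp
    then show ?thesis by (auto simp: eventually_sequentially algebra_simps)
  qed
  then obtain N where N: "\<And>k n. N k \<le> n \<Longrightarrow> L - \<mu> n < (1/8)^k" by metis
  define n where "n k = k + (\<Sum>i\<le>k. N i)" for k
  have n_ge: "k \<le> n k" "N k \<le> n k" for k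
    using member_le_sum[of k "{..k}" N] by (auto simp: n_def intro: order_trans)
  have n_mono: "n k \<le> n (Suc k)" for k by (simp add: n_def)
  have "\<exists>g\<in>mid_hull f (n k). J g < \<mu> (n k) + (1/8)^k" for k
    using cINF_less_iff[OF ne bdd, of "n k" "\<mu> (n k) + (1/8)^k"] unfolding \<mu>_def by simp
  then obtain G where G: "\<And>k. G k \<in> mid_hull f (n k)" "\<And>k. J (G k) < \<mu> (n k) + (1/8)^k" by metis
  define d where "d k = (\<lambda>\<omega>. (1/2) *\<^sub>R (G k \<omega> - G (Suc k) \<omega>))" for k
  have G_sel: "G k \<in> sel" for k using mid_hull_sel[OF f G(1)] .
  have d_int: "integrable M (D (d k))" for k
  proof (rule D_int)
    show "d k \<in> borel_measurable M" unfolding d_def using sel_measurable[OF G_sel] by measurable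
    show "AE \<omega> in M. norm (d k \<omega>) \<le> h \<omega>"
      using sel_bound[OF G_sel[of k]] sel_bound[OF G_sel[of "Suc k"]]
    proof eventually_elim
      fix \<omega> assume "norm (G k \<omega>) \<le> h \<omega>" "norm (G (Suc k) \<omega>) \<le> h \<omega>"
      then show "norm (d k \<omega>) \<le> h \<omega>"
        using norm_triangle_ineq4[of "G k \<omega>" "G (Suc k) \<omega>"] by (simp add: d_def)
    qed
  qed
  have J_d: "J (d k) \<le> 2 * (1/8)^k" for k
  proof -
    let ?m = "\<lambda>\<omega>. (1/2) *\<^sub>R (G k \<omega> + G (Suc k) \<omega>)"
    have G': "G (Suc k) \<in> mid_hull f (n k)" using G(1)[of "Suc k"] mid_hull_mono[OF n_mono] by blast
    have m: "?m \<in> mid_hull f (n k)" by (rule mid_hull.mid[OF G(1) G'])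
    have "J ?m + J (d k) = (LINT \<omega>|M. D ?m \<omega> + D (d k) \<omega>)"
      unfolding J_def by (rule Bochner_Integration.integral_add[symmetric, OF D_sel(1)[OF m] d_int])
    also have "\<dots> = (LINT \<omega>|M. (D (G k) \<omega> + D (G (Suc k)) \<omega>) / 2)"
    proof (rule Bochner_Integration.integral_cong[OF refl])
      fix \<omega>
      have "D ?m \<omega> + D (d k) \<omega> = (quad ys (?m \<omega>) + quad ys (d k \<omega>)) / (1 + h \<omega>)"
        by (simp add: D_def add_divide_distrib)
      also have "\<dots> = (quad ys (G k \<omega>) + quad ys (G (Suc k) \<omega>)) / 2 / (1 + h \<omega>)"
        unfolding d_def by (simp only: quad_parallelogram[OF ys])
      finally show "D ?m \<omega> + D (d k) \<omega> = (D (G k) \<omega> + D (G (Suc k)) \<omega>) / 2"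
        by (simp add: D_def add_divide_distrib mult.commute)
    qed
    also have "\<dots> = (J (G k) + J (G (Suc k))) / 2"
      unfolding J_def using D_sel(1)[OF G(1)] by (simp add: Bochner_Integration.integral_add)
    finally have eq: "J ?m + J (d k) = (J (G k) + J (G (Suc k))) / 2" .
    have "J (G (Suc k)) < L + (1/8)^Suc k" using G(2)[of "Suc k"] L(2)[of "n (Suc k)"] by simp
    also have "\<dots> \<le> L + (1/8)^k" by simp
    finally have "J (G (Suc k)) < L + (1/8)^k" .
    moreover have "J (G k) < L + (1/8)^k" using G(2)[of k] L(2)[of "n k"] by simp
    moreover have "L - (1/8)^k < \<mu> (n k)" using N[OF n_ge(2)[of k]] by simp
    ultimately show ?thesis using eq \<mu>_le[OF m] by simp
  qed
  have "AE \<omega> in M. \<exists>C. \<forall>k. 4^k * D (d k) \<omega> \<le> C"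
  proof (rule AE_bounded_if_summable_integral)
    show "summable (\<lambda>k. LINT \<omega>|M. 4^k * D (d k) \<omega>)"
    proof (rule summable_comparison_test'[of "\<lambda>k. 2 * (1/2)^k" 0])
      show "summable (\<lambda>k. 2 * (1 / 2 :: real) ^ k)" by (intro summable_mult summable_geometric) simp
      fix k :: nat
      have "norm (LINT \<omega>|M. 4^k * D (d k) \<omega>) = 4^k * J (d k)"
        using J_nonneg[of "d k"] by (simp add: J_def)
      also have "\<dots> \<le> 4^k * (2 * (1/8)^k)" by (intro mult_left_mono J_d) simp
      also have "\<dots> = 2 * ((4 :: real) * (1/8))^k" by (simp only: power_mult_distrib mult.left_commute)
      finally show "norm (LINT \<omega>|M. 4^k * D (d k) \<omega>) \<le> 2 * (1/2)^k" by simp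
    qed
  qed (use d_int D_nonneg in auto)
  moreover have "AE \<omega> in M. \<forall>k. G k \<omega> \<in> K \<omega>"
    unfolding AE_all_countable using sel_in[OF G_sel] by blast
  ultimately have "AE \<omega> in M. (\<forall>k. G k \<omega> \<in> K \<omega>) \<and> (\<forall>j. convergent (\<lambda>k. ys j (G k \<omega>)))"
  proof eventually_elim
    fix \<omega> assume "\<exists>C. \<forall>k. 4^k * D (d k) \<omega> \<le> C" and K: "\<forall>k. G k \<omega> \<in> K \<omega>"
    then obtain C where C: "\<And>k. 4^k * D (d k) \<omega> \<le> C" by blast
    have "convergent (\<lambda>k. ys j (G k \<omega>))" for j
    proof (rule convergent_geometric_steps)
      fix k
      let ?B = "2^j * (1 + h \<omega>) * C"
      have "(1/2)^j * (ys j (d k \<omega>))\<^sup>2 \<le> quad ys (d k \<omega>)" by (rule quad_ge[OF ys])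
      also have "\<dots> = D (d k) \<omega> * (1 + h \<omega>)" using h(2)[of \<omega>] by (simp add: D_def)
      finally have "2^j * 4^k * ((1/2)^j * (ys j (d k \<omega>))\<^sup>2) \<le> 2^j * 4^k * (D (d k) \<omega> * (1 + h \<omega>))"
        by (intro mult_left_mono) auto
      also have "\<dots> = 2^j * (1 + h \<omega>) * (4^k * D (d k) \<omega>)" by simp
      also have "\<dots> \<le> ?B" using C[of k] h(2)[of \<omega>] by (intro mult_left_mono) auto
      also have "2^j * 4^k * ((1/2)^j * (ys j (d k \<omega>))\<^sup>2) = (2^k * ys j (d k \<omega>))\<^sup>2"
        by (simp add: power_mult_distrib power_divide power2_eq_square flip: power_mult_distrib)
      finally have "\<bar>2^k * ys j (d k \<omega>)\<bar> \<le> sqrt ?B" by (simp add: real_le_rsqrt real_sqrt_le_mono flip: real_sqrt_abs)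
      then have "\<bar>ys j (d k \<omega>)\<bar> \<le> sqrt ?B * (1/2)^k"
        by (simp add: abs_mult power_divide field_simps)
      moreover have "ys j (G (Suc k) \<omega>) - ys j (G k \<omega>) = - 2 * ys j (d k \<omega>)"
        unfolding d_def using ys by (simp add: norming_def bounded_linear.linear linear_diff linear_cmul)
      ultimately show "norm (ys j (G (Suc k) \<omega>) - ys j (G k \<omega>)) \<le> (2 * sqrt ?B) * (1/2)^k"
        by (simp add: abs_mult)
    qed
    with K show "(\<forall>k. G k \<omega> \<in> K \<omega>) \<and> (\<forall>j. convergent (\<lambda>k. ys j (G k \<omega>)))" by blast
  qed
  then obtain Z where
    "\<And>\<omega>. \<omega> \<in> space M - Z \<Longrightarrow> (\<forall>k. G k \<omega> \<in> K \<omega>) \<and> (\<forall>j. convergent (\<lambda>k. ys j (G k \<omega>)))"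
    "Z \<in> null_sets M"
    by (rule AE_E3) (rule that)
  note Z = this(2,1)
  have "\<exists>x. x \<in> K \<omega> \<and> (\<forall>\<phi>. bounded_linear \<phi> \<longrightarrow> (\<lambda>k. \<phi> (G k \<omega>) :: real) \<longlonglongrightarrow> \<phi> x)"
    if \<omega>: "\<omega> \<in> space M - Z" for \<omega>
  proof -
    have K: "compactin weak_topology (K \<omega>)" using K_compact \<omega> by auto
    have lim: "(\<lambda>k. ys j (G k \<omega>)) \<longlonglongrightarrow> lim (\<lambda>k. ys j (G k \<omega>))" for j
      using Z(2)[OF \<omega>] convergent_LIMSEQ_iff by blast
    show ?thesis using weak_compact_limit[OF K ys _ lim] Z(2)[OF \<omega>] by metis
  qed
  then obtain g0 where g0: "\<And>\<omega>. \<omega> \<in> space M - Z \<Longrightarrow> g0 \<omega> \<in> K \<omega>"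
    "\<And>\<omega> \<phi>. \<omega> \<in> space M - Z \<Longrightarrow> bounded_linear \<phi> \<Longrightarrow> (\<lambda>k. \<phi> (G k \<omega>) :: real) \<longlonglongrightarrow> \<phi> (g0 \<omega>)"
    by metis
  define g where "g \<omega> = (if \<omega> \<in> Z then 0 else g0 \<omega>)" for \<omega>
  have AE_Z: "AE \<omega> in M. \<omega> \<in> space M - Z" using AE_not_in[OF Z(1)] AE_space by auto
  have [measurable]: "Z \<in> sets M" using Z(1) by auto
  have "g \<in> borel_measurable M"
  proof (rule weakly_measurable_imp_measurable[OF ys])
    fix j
    have bl: "bounded_linear (ys j)" using ys by (simp add: norming_def)
    show "(\<lambda>\<omega>. ys j (g \<omega>)) \<in> borel_measurable M"
    proof (rule borel_measurable_LIMSEQ_metric)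
      show "(\<lambda>\<omega>. if \<omega> \<in> Z then 0 else ys j (G k \<omega>)) \<in> borel_measurable M" for k
        using ys_meas[OF sel_measurable[OF G_sel]] by measurable
      show "(\<lambda>k. if \<omega> \<in> Z then 0 else ys j (G k \<omega>)) \<longlonglongrightarrow> ys j (g \<omega>)" if "\<omega> \<in> space M" for \<omega>
        using g0(2)[OF _ bl, of \<omega>] that linear_0[OF bounded_linear.linear[OF bl]] by (auto simp: g_def)
    qed
  qed
  moreover have "AE \<omega> in M. g \<omega> \<in> K \<omega>"
    using AE_Z by eventually_elim (use g0(1) in \<open>auto simp: g_def\<close>)
  ultimately have "g \<in> sel" by (simp add: sel_def)
  moreover have "AE \<omega> in M. \<forall>\<phi>. bounded_linear \<phi> \<longrightarrow> (\<lambda>k. \<phi> (G k \<omega>) :: real) \<longlonglongrightarrow> \<phi> (g \<omega>)"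
    using AE_Z by eventually_elim (use g0(2) in \<open>auto simp: g_def\<close>)
  moreover have "G k \<in> mid_hull f k" for k using G(1)[of k] mid_hull_mono[OF n_ge(1)] by blast
  ultimately show thesis by (intro that[of g G]) auto
qed

end

section \<open>Densities\<close>

lemma L1_class_cong:
  "AE \<omega> in M. f \<omega> = g \<omega> \<Longrightarrow> L1_class M f = L1_class M g"
  unfolding L1_class_def by (auto elim: eventually_elim2)

lemma L1_class_self: "integrable M f \<Longrightarrow> f \<in> L1_class M f"
  by (simp add: L1_class_def)

context finite_measure
begin

lemma AE_le_if_set_integral_le:
  fixes p :: "'a \<Rightarrow> real"
  assumes p: "integrable M p"
    and le: "\<And>B. B \<in> sets M \<Longrightarrow> (LINT \<omega>|M. indicator B \<omega> * p \<omega>) \<le> c * measure M B"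
  shows "AE \<omega> in M. p \<omega> \<le> c"
proof -
  have [measurable]: "p \<in> borel_measurable M" using p by auto
  define B where "B = {\<omega> \<in> space M. c < p \<omega>}"
  have [measurable]: "B \<in> sets M" unfolding B_def by measurable
  define u where "u \<omega> = indicator B \<omega> * p \<omega> - c * indicator B \<omega>" for \<omega>
  have int: "integrable M (\<lambda>\<omega>. indicator B \<omega> * p \<omega>)" "integrable M (\<lambda>\<omega>. c * indicator B \<omega>)"
    using integrable_real_mult_indicator[OF \<open>B \<in> sets M\<close> p] by (auto simp: mult.commute emeasure_eq_measure)
  have nonneg: "AE \<omega> in M. 0 \<le> u \<omega>"
    by (rule AE_I2) (auto simp: u_def B_def indicator_def)
  have "(LINT \<omega>|M. u \<omega>) \<le> 0"
    unfolding u_def using le[of B] by (subst Bochner_Integration.integral_diff[OF int]) simp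
  moreover have "0 \<le> (LINT \<omega>|M. u \<omega>)" by (rule integral_nonneg_AE[OF nonneg])
  moreover have "integrable M u" unfolding u_def by (rule Bochner_Integration.integrable_diff[OF int])
  ultimately have "AE \<omega> in M. u \<omega> = 0" using integral_nonneg_eq_0_iff_AE[OF _ nonneg] by simp
  then show ?thesis
    using AE_space by eventually_elim (auto simp: u_def B_def indicator_def split: if_splits)
qed

lemma set_integral_density:
  fixes \<nu> :: "'a set \<Rightarrow> real"
  assumes add: "\<And>A B. A \<in> sets M \<Longrightarrow> B \<in> sets M \<Longrightarrow> A \<inter> B = {} \<Longrightarrow> \<nu> (A \<union> B) = \<nu> A + \<nu> B"
    and bound: "\<And>A. A \<in> sets M \<Longrightarrow> \<bar>\<nu> A\<bar> \<le> c * measure M A"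
  obtains p where "integrable M p" "\<And>A. A \<in> sets M \<Longrightarrow> \<nu> A = (LINT \<omega>|M. indicator A \<omega> * p \<omega>)"
proof -
  define \<kappa> where "\<kappa> A = \<nu> A + c * measure M A" for A
  have \<kappa>: "0 \<le> \<kappa> A" "\<kappa> A \<le> 2 * c * measure M A" if "A \<in> sets M" for A
    using bound[OF that] by (auto simp: \<kappa>_def abs_le_iff)
  have \<kappa>_empty: "\<kappa> {} = 0" using \<kappa>[of "{}"] by simp
  define N where "N = measure_of (space M) (sets M) (\<lambda>A. ennreal (\<kappa> A))"
  have "countably_additive (sets M) (\<lambda>A. ennreal (\<kappa> A))"
  proof (rule sets.empty_continuous_imp_countably_additive)
    show "positive (sets M) (\<lambda>A. ennreal (\<kappa> A))" by (simp add: positive_def \<kappa>_empty)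
    show "additive (sets M) (\<lambda>A. ennreal (\<kappa> A))"
      unfolding additive_def
    proof (intro ballI impI)
      fix A B assume AB: "A \<in> sets M" "B \<in> sets M" "A \<inter> B = {}"
      then have "\<kappa> (A \<union> B) = \<kappa> A + \<kappa> B"
        using add[OF AB] finite_measure_Union[OF AB] by (simp add: \<kappa>_def algebra_simps)
      then show "ennreal (\<kappa> (A \<union> B)) = ennreal (\<kappa> A) + ennreal (\<kappa> B)" using \<kappa>(1) AB by simp
    qed
    fix A :: "nat \<Rightarrow> 'a set" assume A: "range A \<subseteq> sets M" "decseq A" "(\<Inter>i. A i) = {}"
    have "(\<lambda>i. 2 * c * measure M (A i)) \<longlonglongrightarrow> 2 * c * measure M (\<Inter>i. A i)"
      by (intro tendsto_intros finite_Lim_measure_decseq A)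
    then have "(\<lambda>i. 2 * c * measure M (A i)) \<longlonglongrightarrow> 0" using A(3) by simp
    then have "(\<lambda>i. \<kappa> (A i)) \<longlonglongrightarrow> 0"
      by (rule tendsto_sandwich[OF _ _ tendsto_const, rotated 2]) (use \<kappa> A(1) in auto)
    then show "(\<lambda>i. ennreal (\<kappa> (A i))) \<longlonglongrightarrow> 0"
      using tendsto_ennrealI ennreal_0 by metis
  qed simp
  then have em: "emeasure N A = ennreal (\<kappa> A)" if "A \<in> sets M" for A
    unfolding N_def using that
    by (intro emeasure_measure_of_sigma[OF sets.sigma_algebra_axioms]) (auto simp: positive_def \<kappa>_empty)
  have sets_N: "sets N = sets M" by (simp add: N_def)
  have "absolutely_continuous M N"
    unfolding absolutely_continuous_def
  proof
    fix A assume A: "A \<in> null_sets M"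
    then have "A \<in> sets M" "measure M A = 0" by (auto simp: null_sets_def measure_def)
    with \<kappa>[of A] em[of A] show "A \<in> null_sets N" by (simp add: null_sets_def sets_N)
  qed
  then obtain F where F [measurable]: "F \<in> borel_measurable M" and dF: "density M F = N"
    using Radon_Nikodym sets_N by blast
  have nn: "(\<integral>\<^sup>+\<omega>. F \<omega> * indicator A \<omega> \<partial>M) = ennreal (\<kappa> A)" if "A \<in> sets M" for A
    using em[OF that] emeasure_density[OF F that] dF by simp
  have "(\<integral>\<^sup>+\<omega>. F \<omega> \<partial>M) = (\<integral>\<^sup>+\<omega>. F \<omega> * indicator (space M) \<omega> \<partial>M)"
    by (intro nn_integral_cong) simp
  then have fin: "(\<integral>\<^sup>+\<omega>. F \<omega> \<partial>M) \<noteq> \<infinity>" using nn[of "space M"] by simp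
  then have AE_F: "AE \<omega> in M. F \<omega> = ennreal (enn2real (F \<omega>))"
    using nn_integral_noteq_infinite[OF F fin] by (auto elim!: eventually_mono simp: less_top)
  have int: "integrable M (\<lambda>\<omega>. enn2real (F \<omega>))"
  proof (rule integrableI_nonneg)
    have "(\<integral>\<^sup>+\<omega>. ennreal (enn2real (F \<omega>)) \<partial>M) = (\<integral>\<^sup>+\<omega>. F \<omega> \<partial>M)"
      by (rule nn_integral_cong_AE) (use AE_F in \<open>auto elim!: eventually_mono\<close>)
    then show "(\<integral>\<^sup>+\<omega>. ennreal (enn2real (F \<omega>)) \<partial>M) < \<infinity>" using fin by (simp add: less_top)
  qed auto
  show thesis
  proof (rule that[of "\<lambda>\<omega>. enn2real (F \<omega>) - c"])
    show "integrable M (\<lambda>\<omega>. enn2real (F \<omega>) - c)" using int by auto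
    fix A assume A [measurable]: "A \<in> sets M"
    have intA: "integrable M (\<lambda>\<omega>. indicator A \<omega> * enn2real (F \<omega>))"
      using integrable_real_mult_indicator[OF A int] by (simp add: mult.commute)
    have "ennreal (LINT \<omega>|M. indicator A \<omega> * enn2real (F \<omega>)) = (\<integral>\<^sup>+\<omega>. ennreal (indicator A \<omega> * enn2real (F \<omega>)) \<partial>M)"
      by (rule nn_integral_eq_integral[symmetric, OF intA]) simp
    also have "\<dots> = (\<integral>\<^sup>+\<omega>. F \<omega> * indicator A \<omega> \<partial>M)"
      by (rule nn_integral_cong_AE) (use AE_F in \<open>auto elim!: eventually_mono simp: indicator_def\<close>)
    also have "\<dots> = ennreal (\<kappa> A)" by (rule nn[OF A])
    finally have "(LINT \<omega>|M. indicator A \<omega> * enn2real (F \<omega>)) = \<kappa> A"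
      using \<kappa>(1)[OF A] by (subst (asm) ennreal_inj) (auto intro!: Bochner_Integration.integral_nonneg)
    moreover have "(LINT \<omega>|M. indicator A \<omega> * (enn2real (F \<omega>) - c))
        = (LINT \<omega>|M. indicator A \<omega> * enn2real (F \<omega>)) - (LINT \<omega>|M. indicator A \<omega> * c)"
      unfolding right_diff_distrib using intA by (intro Bochner_Integration.integral_diff) (auto simp: emeasure_eq_measure)
    ultimately show "\<nu> A = (LINT \<omega>|M. indicator A \<omega> * (enn2real (F \<omega>) - c))"
      by (simp add: \<kappa>_def)
  qed
qed

end

section \<open>Representation of the dual of the Bochner space\<close>

context finite_measure
begin

text \<open>For each vector \<open>y\<close> the set function \<open>A \<mapsto> \<phi> (1\<^sub>A y)\<close> has a density; off one null set, the densities
  of a dense sequence of vectors are Lipschitz and linear, and extend to all vectors.\<close>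

lemma L1_dual_representation:
  fixes \<phi> :: "('a \<Rightarrow> 'b::{banach, second_countable_topology}) set \<Rightarrow> real"
  assumes \<phi>: "\<phi> \<in> L1_dual M"
  obtains q C where "\<And>\<omega>. bounded_linear (q \<omega>)" "\<And>\<omega> y. \<bar>q \<omega> y\<bar> \<le> C * norm y"
    "\<And>f. integrable M f \<Longrightarrow> integrable M (\<lambda>\<omega>. q \<omega> (f \<omega>))"
    "\<And>f. integrable M f \<Longrightarrow> \<phi> (L1_class M f) = (LINT \<omega>|M. q \<omega> (f \<omega>))"
proof -
  define \<Phi> where "\<Phi> f = \<phi> (L1_class M f)" for f
  have \<Phi>_add: "\<Phi> (\<lambda>\<omega>. f \<omega> + g \<omega>) = \<Phi> f + \<Phi> g" if "integrable M f" "integrable M g" for f g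
    using \<phi> that by (simp add: \<Phi>_def L1_dual_def)
  have \<Phi>_scale: "\<Phi> (\<lambda>\<omega>. c *\<^sub>R f \<omega>) = c * \<Phi> f" if "integrable M f" for c f
    using \<phi> that by (simp add: \<Phi>_def L1_dual_def)
  obtain C0 where C0: "\<And>f. integrable M f \<Longrightarrow> \<bar>\<Phi> f\<bar> \<le> C0 * (LINT \<omega>|M. norm (f \<omega>))"
    using \<phi> by (auto simp: \<Phi>_def L1_dual_def)
  define C where "C = max C0 0"
  have C: "0 \<le> C" by (simp add: C_def)
  have \<Phi>_bound: "\<bar>\<Phi> f\<bar> \<le> C * (LINT \<omega>|M. norm (f \<omega>))" if "integrable M f" for f
    using C0[OF that] by (rule order_trans) (intro mult_right_mono, auto simp: C_def)
  have \<Phi>_diff: "\<Phi> (\<lambda>\<omega>. f \<omega> - g \<omega>) = \<Phi> f - \<Phi> g" if "integrable M f" "integrable M g" for f g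
    using \<Phi>_add[of f "\<lambda>\<omega>. (-1) *\<^sub>R g \<omega>"] \<Phi>_scale[of g "-1"] that by simp
  have int_ind: "integrable M (\<lambda>\<omega>. indicator A \<omega> *\<^sub>R y)" if "A \<in> sets M" for A and y :: 'b
    using that by (simp add: emeasure_eq_measure)
  have \<Phi>_ind: "\<bar>\<Phi> (\<lambda>\<omega>. indicator A \<omega> *\<^sub>R y)\<bar> \<le> C * norm y * measure M A" if A: "A \<in> sets M" for A y
    using \<Phi>_bound[OF int_ind[OF A, of y]] A by (simp add: mult_ac)
  have "\<exists>p. integrable M p \<and> (\<forall>A\<in>sets M. \<Phi> (\<lambda>\<omega>. indicator A \<omega> *\<^sub>R y) = (LINT \<omega>|M. indicator A \<omega> * p \<omega>))" for y
  proof (rule set_integral_density[of "\<lambda>A. \<Phi> (\<lambda>\<omega>. indicator A \<omega> *\<^sub>R y)"])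
    show "\<bar>\<Phi> (\<lambda>\<omega>. indicator A \<omega> *\<^sub>R y)\<bar> \<le> C * norm y * measure M A" if "A \<in> sets M" for A
      by (rule \<Phi>_ind[OF that])
    fix A B assume AB: "A \<in> sets M" "B \<in> sets M" "A \<inter> B = {}"
    have "(\<lambda>\<omega>. indicator (A \<union> B) \<omega> *\<^sub>R y) = (\<lambda>\<omega>. indicator A \<omega> *\<^sub>R y + indicator B \<omega> *\<^sub>R y)"
      using AB(3) by (auto simp: fun_eq_iff indicator_def)
    then show "\<Phi> (\<lambda>\<omega>. indicator (A \<union> B) \<omega> *\<^sub>R y) = \<Phi> (\<lambda>\<omega>. indicator A \<omega> *\<^sub>R y) + \<Phi> (\<lambda>\<omega>. indicator B \<omega> *\<^sub>R y)"
      using \<Phi>_add[OF int_ind[OF AB(1)] int_ind[OF AB(2)], of y y] by (simp only:)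
  qed blast
  then obtain p where p: "\<And>y. integrable M (p y)"
    "\<And>y A. A \<in> sets M \<Longrightarrow> \<Phi> (\<lambda>\<omega>. indicator A \<omega> *\<^sub>R y) = (LINT \<omega>|M. indicator A \<omega> * p y \<omega>)" by metis
  have [measurable]: "p y \<in> borel_measurable M" for y using p(1) by auto
  have comb: "AE \<omega> in M. \<bar>s * p u \<omega> + t * p v \<omega> - p w \<omega>\<bar> \<le> C * norm (s *\<^sub>R u + t *\<^sub>R v - w)" for s t u v w
  proof -
    define r where "r \<omega> = s * p u \<omega> + t * p v \<omega> - p w \<omega>" for \<omega>
    have r: "integrable M r" unfolding r_def using p(1) by auto
    have int_A: "(LINT \<omega>|M. indicator A \<omega> * r \<omega>) = \<Phi> (\<lambda>\<omega>. indicator A \<omega> *\<^sub>R (s *\<^sub>R u + t *\<^sub>R v - w))"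
      if A: "A \<in> sets M" for A
    proof -
      have ip: "integrable M (\<lambda>\<omega>. indicator A \<omega> * p y \<omega>)" for y
        using integrable_real_mult_indicator[OF A p(1)] by (simp add: mult.commute)
      have "(LINT \<omega>|M. indicator A \<omega> * r \<omega>)
          = (LINT \<omega>|M. s * (indicator A \<omega> * p u \<omega>) + t * (indicator A \<omega> * p v \<omega>) - indicator A \<omega> * p w \<omega>)"
        by (intro Bochner_Integration.integral_cong) (auto simp: r_def algebra_simps)
      also have "\<dots> = s * \<Phi> (\<lambda>\<omega>. indicator A \<omega> *\<^sub>R u) + t * \<Phi> (\<lambda>\<omega>. indicator A \<omega> *\<^sub>R v) - \<Phi> (\<lambda>\<omega>. indicator A \<omega> *\<^sub>R w)"
        using ip by (simp add: p(2)[OF A])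
      also have "\<dots> = \<Phi> (\<lambda>\<omega>. (s *\<^sub>R (indicator A \<omega> *\<^sub>R u) + t *\<^sub>R (indicator A \<omega> *\<^sub>R v)) - indicator A \<omega> *\<^sub>R w)"
      proof -
        have i1: "integrable M (\<lambda>\<omega>. s *\<^sub>R (indicator A \<omega> *\<^sub>R u))" and i2: "integrable M (\<lambda>\<omega>. t *\<^sub>R (indicator A \<omega> *\<^sub>R v))"
          by (intro integrable_scaleR_right int_ind[OF A])+
        show ?thesis
          unfolding \<Phi>_diff[OF Bochner_Integration.integrable_add[OF i1 i2] int_ind[OF A]] \<Phi>_add[OF i1 i2] \<Phi>_scale[OF int_ind[OF A]] ..
      qed
      also have "\<dots> = \<Phi> (\<lambda>\<omega>. indicator A \<omega> *\<^sub>R (s *\<^sub>R u + t *\<^sub>R v - w))"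
        by (rule arg_cong[of _ _ \<Phi>]) (auto simp: fun_eq_iff indicator_def)
      finally show ?thesis .
    qed
    have "AE \<omega> in M. r \<omega> \<le> C * norm (s *\<^sub>R u + t *\<^sub>R v - w)"
      by (rule AE_le_if_set_integral_le[OF r]) (use int_A \<Phi>_ind in \<open>auto simp: abs_le_iff\<close>)
    moreover have "AE \<omega> in M. - r \<omega> \<le> C * norm (s *\<^sub>R u + t *\<^sub>R v - w)"
    proof (rule AE_le_if_set_integral_le)
      show "integrable M (\<lambda>\<omega>. - r \<omega>)" using r by auto
      show "(LINT \<omega>|M. indicator B \<omega> * - r \<omega>) \<le> C * norm (s *\<^sub>R u + t *\<^sub>R v - w) * measure M B" if "B \<in> sets M" for B
        using int_A[OF that] \<Phi>_ind[OF that, of "s *\<^sub>R u + t *\<^sub>R v - w"] by (simp add: abs_le_iff)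
    qed
    ultimately show ?thesis by eventually_elim (simp add: r_def abs_le_iff)
  qed
  have lip: "AE \<omega> in M. \<bar>p u \<omega> - p v \<omega>\<bar> \<le> C * norm (u - v)" for u v
    using comb[of 1 u 0 0 v] by simp
  obtain d :: "nat \<Rightarrow> 'b" where d: "\<And>y e. 0 < e \<Longrightarrow> \<exists>i. dist (d i) y < e"
    using dense_sequence by blast
  obtain r :: "nat \<Rightarrow> real" where r: "\<And>y e. 0 < e \<Longrightarrow> \<exists>i. dist (r i) y < e"
    using dense_sequence by blast
  have "\<exists>\<sigma>. \<forall>n. dist (d (\<sigma> n)) y < 1 / Suc n" for y by (intro choice allI d) simp
  then obtain \<sigma> where \<sigma>: "\<And>y n. dist (d (\<sigma> y n)) y < 1 / Suc n" by metis
  have "\<exists>\<rho>. \<forall>n. dist (r (\<rho> n)) s < 1 / Suc n" for s by (intro choice allI r) simp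
  then obtain \<rho> where \<rho>: "\<And>s n. dist (r (\<rho> s n)) s < 1 / Suc n" by metis
  have inv_Suc: "(\<lambda>n. 1 / real (Suc n)) \<longlonglongrightarrow> 0"
    using LIMSEQ_inverse_real_of_nat by (simp add: inverse_eq_divide)
  have d_lim: "(\<lambda>n. d (\<sigma> y n)) \<longlonglongrightarrow> y" for y
    by (rule iffD2[OF tendsto_dist_iff], rule Lim_null_comparison[OF _ inv_Suc]) (use less_imp_le[OF \<sigma>] in simp)
  have r_lim: "(\<lambda>n. r (\<rho> s n)) \<longlonglongrightarrow> s" for s
    by (rule iffD2[OF tendsto_dist_iff], rule Lim_null_comparison[OF _ inv_Suc]) (use less_imp_le[OF \<rho>] in simp)
  have "AE \<omega> in M. (\<forall>i j. \<bar>p (d i) \<omega> - p (d j) \<omega>\<bar> \<le> C * norm (d i - d j)) \<and>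
      (\<forall>i j k a b. \<bar>r a * p (d i) \<omega> + r b * p (d j) \<omega> - p (d k) \<omega>\<bar> \<le> C * norm (r a *\<^sub>R d i + r b *\<^sub>R d j - d k))"
    unfolding AE_conj_iff AE_all_countable by (intro conjI allI lip comb)
  then obtain Z where
    "\<And>\<omega>. \<omega> \<in> space M - Z \<Longrightarrow> (\<forall>i j. \<bar>p (d i) \<omega> - p (d j) \<omega>\<bar> \<le> C * norm (d i - d j)) \<and>
      (\<forall>i j k a b. \<bar>r a * p (d i) \<omega> + r b * p (d j) \<omega> - p (d k) \<omega>\<bar> \<le> C * norm (r a *\<^sub>R d i + r b *\<^sub>R d j - d k))"
    "Z \<in> null_sets M"
    by (rule AE_E3) (rule that)
  then have Z_lip: "\<And>\<omega> i j. \<omega> \<in> space M - Z \<Longrightarrow> \<bar>p (d i) \<omega> - p (d j) \<omega>\<bar> \<le> C * norm (d i - d j)"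
    and Z_comb: "\<And>\<omega> i j k a b. \<omega> \<in> space M - Z \<Longrightarrow>
      \<bar>r a * p (d i) \<omega> + r b * p (d j) \<omega> - p (d k) \<omega>\<bar> \<le> C * norm (r a *\<^sub>R d i + r b *\<^sub>R d j - d k)"
    and Z: "Z \<in> null_sets M"
    by blast+
  have [measurable]: "Z \<in> sets M" using Z by auto
  have AE_Z: "AE \<omega> in M. \<omega> \<in> space M - Z" using AE_not_in[OF Z] AE_space by auto
  define q where "q \<omega> y = (if \<omega> \<in> space M - Z then lim (\<lambda>n. p (d (\<sigma> y n)) \<omega>) else 0)" for \<omega> y
  have q_meas [measurable]: "(\<lambda>\<omega>. q \<omega> y) \<in> borel_measurable M" for y
    unfolding q_def by measurable
  have q_lim: "(\<lambda>n. p (d (\<sigma> y n)) \<omega>) \<longlonglongrightarrow> q \<omega> y" if \<omega>: "\<omega> \<in> space M - Z" for \<omega> y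
  proof -
    have "Cauchy (\<lambda>n. p (d (\<sigma> y n)) \<omega>)"
    proof (rule metric_CauchyI)
      fix e :: real assume e: "0 < e"
      obtain N where N: "\<And>m n. N \<le> m \<Longrightarrow> N \<le> n \<Longrightarrow> dist (d (\<sigma> y m)) (d (\<sigma> y n)) < e / (C + 1)"
        using metric_CauchyD[OF LIMSEQ_imp_Cauchy[OF d_lim[of y]], of "e / (C + 1)"] e C by (auto simp: field_simps)
      have "dist (p (d (\<sigma> y m)) \<omega>) (p (d (\<sigma> y n)) \<omega>) < e" if "N \<le> m" "N \<le> n" for m n
      proof -
        have "dist (p (d (\<sigma> y m)) \<omega>) (p (d (\<sigma> y n)) \<omega>) \<le> C * dist (d (\<sigma> y m)) (d (\<sigma> y n))"
          using Z_lip[OF \<omega>] by (simp add: dist_real_def dist_norm)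
        also have "\<dots> \<le> (C + 1) * dist (d (\<sigma> y m)) (d (\<sigma> y n))" by (simp add: mult_right_mono)
        also have "\<dots> < e" using N[OF that] C by (simp add: pos_less_divide_eq mult.commute)
        finally show ?thesis .
      qed
      then show "\<exists>N. \<forall>m\<ge>N. \<forall>n\<ge>N. dist (p (d (\<sigma> y m)) \<omega>) (p (d (\<sigma> y n)) \<omega>) < e" by blast
    qed
    then have "convergent (\<lambda>n. p (d (\<sigma> y n)) \<omega>)" by (rule Cauchy_convergent)
    then show ?thesis using \<omega> by (simp add: q_def convergent_LIMSEQ_iff)
  qed
  have q_comb: "\<bar>s * q \<omega> u + t * q \<omega> v - q \<omega> w\<bar> \<le> C * norm (s *\<^sub>R u + t *\<^sub>R v - w)" for \<omega> s t u v w
  proof (cases "\<omega> \<in> space M - Z")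
    case True
    show ?thesis
    proof (rule LIMSEQ_le)
      show "(\<lambda>n. \<bar>r (\<rho> s n) * p (d (\<sigma> u n)) \<omega> + r (\<rho> t n) * p (d (\<sigma> v n)) \<omega> - p (d (\<sigma> w n)) \<omega>\<bar>)
          \<longlonglongrightarrow> \<bar>s * q \<omega> u + t * q \<omega> v - q \<omega> w\<bar>"
        by (intro tendsto_intros r_lim q_lim[OF True])
      show "(\<lambda>n. C * norm (r (\<rho> s n) *\<^sub>R d (\<sigma> u n) + r (\<rho> t n) *\<^sub>R d (\<sigma> v n) - d (\<sigma> w n)))
          \<longlonglongrightarrow> C * norm (s *\<^sub>R u + t *\<^sub>R v - w)"
        by (intro tendsto_intros r_lim d_lim)
    qed (use Z_comb[OF True] in blast)
  next
    case False
    then have "q \<omega> = (\<lambda>y. 0)" by (auto simp: q_def fun_eq_iff)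
    then show ?thesis using C by simp
  qed
  have q_bound: "\<bar>q \<omega> y\<bar> \<le> C * norm y" for \<omega> y
    using q_comb[of 0 \<omega> y 0 y y] by simp
  have q_lin: "bounded_linear (q \<omega>)" for \<omega>
  proof (rule bounded_linear_intro[where K = C])
    show "q \<omega> (x + y) = q \<omega> x + q \<omega> y" for x y using q_comb[of 1 \<omega> x 1 y "x + y"] by simp
    show "q \<omega> (c *\<^sub>R x) = c *\<^sub>R q \<omega> x" for c x using q_comb[of c \<omega> x 0 x "c *\<^sub>R x"] by simp
    show "norm (q \<omega> x) \<le> norm x * C" for x using q_bound[of \<omega> x] by (simp add: mult.commute)
  qed
  have q_eq: "AE \<omega> in M. q \<omega> y = p y \<omega>" for y
  proof -
    have "AE \<omega> in M. \<forall>i. \<bar>p (d i) \<omega> - p y \<omega>\<bar> \<le> C * norm (d i - y)"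
      unfolding AE_all_countable by (intro allI lip)
    then show ?thesis using AE_Z
    proof eventually_elim
      fix \<omega> assume b: "\<forall>i. \<bar>p (d i) \<omega> - p y \<omega>\<bar> \<le> C * norm (d i - y)" and \<omega>: "\<omega> \<in> space M - Z"
      have "(\<lambda>n. C * norm (d (\<sigma> y n) - y)) \<longlonglongrightarrow> C * norm (y - y)" by (intro tendsto_intros d_lim)
      then have zero: "(\<lambda>n. C * norm (d (\<sigma> y n) - y)) \<longlonglongrightarrow> 0" by simp
      have "(\<lambda>n. p (d (\<sigma> y n)) \<omega> - p y \<omega>) \<longlonglongrightarrow> 0"
        by (rule Lim_null_comparison[OF _ zero]) (use b in simp)
      then have "(\<lambda>n. p (d (\<sigma> y n)) \<omega>) \<longlonglongrightarrow> p y \<omega>" by (rule LIM_zero_cancel)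
      then show "q \<omega> y = p y \<omega>" by (rule LIMSEQ_unique[OF q_lim[OF \<omega>]])
    qed
  qed
  have rep: "integrable M (\<lambda>\<omega>. q \<omega> (f \<omega>)) \<and> \<Phi> f = (LINT \<omega>|M. q \<omega> (f \<omega>))" if "integrable M f" for f
    using that
  proof (induction rule: integrable_induct)
    case (base A c)
    have eq: "q \<omega> (indicator A \<omega> *\<^sub>R c) = indicator A \<omega> * q \<omega> c" for \<omega>
      using linear_cmul[OF bounded_linear.linear[OF q_lin]] by simp
    have ae: "AE \<omega> in M. indicator A \<omega> * q \<omega> c = indicator A \<omega> * p c \<omega>"
      using q_eq[of c] by eventually_elim simp
    have "integrable M (\<lambda>\<omega>. indicator A \<omega> * p c \<omega>)"
      using integrable_real_mult_indicator[OF base(1) p(1)] by (simp add: mult.commute)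
    then show ?case
      unfolding eq p(2)[OF base(1)] using base(1) ae
      by (subst integrable_cong_AE[OF _ _ ae]) (auto intro!: integral_cong_AE)
  next
    case (add f g)
    then show ?case
      using linear_add[OF bounded_linear.linear[OF q_lin]] by (simp add: \<Phi>_add)
  next
    case (lim f s)
    have q_meas_s: "(\<lambda>\<omega>. q \<omega> (s i \<omega>)) \<in> borel_measurable M" for i using lim.IH by auto
    have q_conv: "(\<lambda>i. q \<omega> (s i \<omega>)) \<longlonglongrightarrow> q \<omega> (f \<omega>)" if "\<omega> \<in> space M" for \<omega>
      by (rule bounded_linear.tendsto[OF q_lin lim.hyps(2)[OF that]])
    have q_meas_f: "(\<lambda>\<omega>. q \<omega> (f \<omega>)) \<in> borel_measurable M"
      by (rule borel_measurable_LIMSEQ_metric[OF q_meas_s q_conv])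
    have w: "integrable M (\<lambda>\<omega>. C * (2 * norm (f \<omega>)))" using lim.hyps(4) by auto
    have bd: "AE \<omega> in M. norm (q \<omega> (s i \<omega>)) \<le> C * (2 * norm (f \<omega>))" for i
      using AE_space
    proof eventually_elim
      fix \<omega> assume "\<omega> \<in> space M"
      then have "C * norm (s i \<omega>) \<le> C * (2 * norm (f \<omega>))" using lim.hyps(3) C by (intro mult_left_mono)
      with q_bound[of \<omega> "s i \<omega>"] show "norm (q \<omega> (s i \<omega>)) \<le> C * (2 * norm (f \<omega>))" by simp
    qed
    have ae_conv: "AE \<omega> in M. (\<lambda>i. q \<omega> (s i \<omega>)) \<longlonglongrightarrow> q \<omega> (f \<omega>)" using AE_space q_conv by (auto elim!: eventually_mono)
    note dct = q_meas_f q_meas_s w ae_conv bd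
    have lim1: "(\<lambda>i. LINT \<omega>|M. q \<omega> (s i \<omega>)) \<longlonglongrightarrow> (LINT \<omega>|M. q \<omega> (f \<omega>))"
      by (rule integral_dominated_convergence[OF dct])
    have "(\<lambda>i. LINT \<omega>|M. norm (s i \<omega> - f \<omega>)) \<longlonglongrightarrow> (LINT \<omega>|M. (0::real))"
    proof (rule integral_dominated_convergence)
      show "integrable M (\<lambda>\<omega>. 3 * norm (f \<omega>))" using lim.hyps(4) by auto
      show "AE \<omega> in M. (\<lambda>i. norm (s i \<omega> - f \<omega>)) \<longlonglongrightarrow> 0"
        using AE_space by eventually_elim (use lim.hyps(2) in \<open>simp add: tendsto_norm_zero_iff LIM_zero_iff\<close>)
      show "AE \<omega> in M. norm (norm (s i \<omega> - f \<omega>)) \<le> 3 * norm (f \<omega>)" for i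
        using AE_space
      proof eventually_elim
        fix \<omega> assume "\<omega> \<in> space M"
        then show "norm (norm (s i \<omega> - f \<omega>)) \<le> 3 * norm (f \<omega>)"
          using lim.hyps(3)[of \<omega> i] norm_triangle_ineq4[of "s i \<omega>" "f \<omega>"] by simp
      qed
    qed (use lim.hyps(1,4) in auto)
    then have zero: "(\<lambda>i. C * (LINT \<omega>|M. norm (s i \<omega> - f \<omega>))) \<longlonglongrightarrow> 0"
      by (intro tendsto_mult_right_zero) simp
    have "(\<lambda>i. \<Phi> (s i) - \<Phi> f) \<longlonglongrightarrow> 0"
    proof (rule Lim_null_comparison[OF always_eventually zero], intro allI)
      fix i
      show "norm (\<Phi> (s i) - \<Phi> f) \<le> C * (LINT \<omega>|M. norm (s i \<omega> - f \<omega>))"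
        using \<Phi>_bound[of "\<lambda>\<omega>. s i \<omega> - f \<omega>"] lim.hyps(1,4) by (simp add: \<Phi>_diff)
    qed
    then have "(\<lambda>i. \<Phi> (s i)) \<longlonglongrightarrow> \<Phi> f" by (rule LIM_zero_cancel)
    moreover have "\<Phi> (s i) = (LINT \<omega>|M. q \<omega> (s i \<omega>))" for i using lim.IH by blast
    ultimately have "\<Phi> f = (LINT \<omega>|M. q \<omega> (f \<omega>))" using lim1 by (simp add: LIMSEQ_unique)
    with integrable_dominated_convergence[OF dct] show ?case by blast
  qed
  show thesis
    by (rule that[of q C]) (use q_lin q_bound rep in \<open>auto simp: \<Phi>_def\<close>)
qed

end

section \<open>Weak compactness of the set of integrable selections\<close>

lemma L1_dual_add:
  assumes "\<phi> \<in> L1_dual M" "integrable M f" "integrable M g"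
  shows "\<phi> (L1_class M (\<lambda>\<omega>. f \<omega> + g \<omega>)) = \<phi> (L1_class M f) + \<phi> (L1_class M g)"
  using assms by (simp add: L1_dual_def)

lemma L1_dual_scale:
  assumes "\<phi> \<in> L1_dual M" "integrable M f"
  shows "\<phi> (L1_class M (\<lambda>\<omega>. c *\<^sub>R f \<omega>)) = c * \<phi> (L1_class M f)"
  using assms by (simp add: L1_dual_def)

lemma L1_dual_sum:
  fixes f :: "nat \<Rightarrow> 'a \<Rightarrow> 'b::{banach, second_countable_topology}"
  assumes \<phi>: "\<phi> \<in> L1_dual M" and f: "\<And>i. i < m \<Longrightarrow> integrable M (f i)"
  shows "\<phi> (L1_class M (\<lambda>\<omega>. \<Sum>i<m. t i *\<^sub>R f i \<omega>)) = (\<Sum>i<m. t i * \<phi> (L1_class M (f i)))"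
  using f
proof (induction m)
  case 0
  show ?case using L1_dual_scale[OF \<phi>, of "\<lambda>_. 0" 0] by simp
next
  case (Suc m)
  have "integrable M (\<lambda>\<omega>. \<Sum>i<m. t i *\<^sub>R f i \<omega>)" "integrable M (\<lambda>\<omega>. t m *\<^sub>R f m \<omega>)"
    using Suc.prems by auto
  from L1_dual_add[OF \<phi> this] show ?case
    using Suc L1_dual_scale[OF \<phi>, of "f m" "t m"] by simp
qed

definition set_functional :: "'a measure \<Rightarrow> 'a set \<Rightarrow> ('b \<Rightarrow> real) \<Rightarrow>
    ('a \<Rightarrow> 'b::{banach, second_countable_topology}) set \<Rightarrow> real" where
  "set_functional M B f' u = (LINT \<omega>|M. indicator B \<omega> * f' ((SOME f. f \<in> u) \<omega>))"

lemma set_functional_class: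
  assumes f: "integrable M f" and B [measurable]: "B \<in> sets M" and f': "bounded_linear f'"
  shows "integrable M (\<lambda>\<omega>. indicator B \<omega> * f' (f \<omega>))"
    and "set_functional M B f' (L1_class M f) = (LINT \<omega>|M. indicator B \<omega> * f' (f \<omega>))"
proof -
  have int: "integrable M (\<lambda>\<omega>. indicator B \<omega> * f' (g \<omega>))" if "integrable M g" for g
    using integrable_real_mult_indicator[OF B integrable_bounded_linear[OF f' that]] by (simp add: mult.commute)
  show "integrable M (\<lambda>\<omega>. indicator B \<omega> * f' (f \<omega>))" by (rule int[OF f])
  define g where "g = (SOME g. g \<in> L1_class M f)"
  have "g \<in> L1_class M f" unfolding g_def by (rule someI[of _ f]) (rule L1_class_self[OF f])
  then have g: "integrable M g" "AE \<omega> in M. g \<omega> = f \<omega>" by (auto simp: L1_class_def)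
  show "set_functional M B f' (L1_class M f) = (LINT \<omega>|M. indicator B \<omega> * f' (f \<omega>))"
    unfolding set_functional_def g_def[symmetric]
    by (rule integral_cong_AE) (use g int[OF f] int[OF g(1)] in \<open>auto elim!: eventually_mono\<close>)
qed

lemma set_functional_dual:
  assumes B: "B \<in> sets M" and f': "bounded_linear f'"
  shows "set_functional M B f' \<in> L1_dual M"
proof -
  note sf = set_functional_class[OF _ B f']
  note lin = bounded_linear.linear[OF f']
  obtain C where C: "\<And>y. \<bar>f' y\<bar> \<le> norm y * C" using bounded_linear.bounded[OF f'] by auto
  have C': "\<bar>f' y\<bar> \<le> max C 0 * norm y" for y
    using C[of y] by (rule order_trans) (subst mult.commute, rule mult_right_mono, auto)
  have "\<bar>set_functional M B f' (L1_class M f)\<bar> \<le> max C 0 * (LINT \<omega>|M. norm (f \<omega>))" if f: "integrable M f" for f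
  proof -
    have "\<bar>set_functional M B f' (L1_class M f)\<bar> \<le> (LINT \<omega>|M. norm (indicator B \<omega> * f' (f \<omega>)))"
      unfolding sf(2)[OF f] using integral_norm_bound by (metis real_norm_def)
    also have "\<dots> \<le> (LINT \<omega>|M. max C 0 * norm (f \<omega>))"
    proof (rule integral_mono)
      show "norm (indicator B \<omega> * f' (f \<omega>)) \<le> max C 0 * norm (f \<omega>)" for \<omega>
        using C'[of "f \<omega>"] by (auto simp: indicator_def)
    qed (use f sf(1)[OF f] in \<open>auto simp del: real_norm_def\<close>)
    also have "\<dots> = max C 0 * (LINT \<omega>|M. norm (f \<omega>))" by simp
    finally show ?thesis .
  qed
  moreover have "set_functional M B f' (L1_class M (\<lambda>\<omega>. f \<omega> + g \<omega>))
      = set_functional M B f' (L1_class M f) + set_functional M B f' (L1_class M g)"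
    if "integrable M f" "integrable M g" for f g
    using sf[OF that(1)] sf[OF that(2)] sf(2)[OF Bochner_Integration.integrable_add[OF that]]
    by (simp add: linear_add[OF lin] distrib_left)
  moreover have "set_functional M B f' (L1_class M (\<lambda>\<omega>. c *\<^sub>R f \<omega>)) = c * set_functional M B f' (L1_class M f)"
    if "integrable M f" for c f
    using sf[OF that] sf(2)[OF integrable_scaleR_right[OF that, of c]]
    by (simp add: linear_cmul[OF lin] mult.left_commute)
  ultimately show ?thesis unfolding L1_dual_def by blast
qed

lemma (in finite_measure) AE_zero_if_dense_set_integrals_zero:
  fixes D :: "'a \<Rightarrow> real"
  assumes D: "integrable M D" and B: "\<And>i :: nat. B i \<in> sets M"
    and dense: "\<And>A e. A \<in> sets M \<Longrightarrow> 0 < e \<Longrightarrow> \<exists>i. measure M (sym_diff A (B i)) < e"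
    and zero: "\<And>i. (LINT \<omega>|M. indicator (B i) \<omega> * D \<omega>) = 0"
  shows "AE \<omega> in M. D \<omega> = 0"
proof -
  have [measurable]: "D \<in> borel_measurable M" "\<And>i. B i \<in> sets M" using D B by auto
  have all: "(LINT \<omega>|M. indicator A \<omega> * D \<omega>) = 0" if A [measurable]: "A \<in> sets M" for A
  proof -
    have "\<exists>i. \<forall>n. measure M (sym_diff A (B (i n))) < 1 / Suc n" by (intro choice allI dense[OF A]) simp
    then obtain i where i: "\<And>n. measure M (sym_diff A (B (i n))) < 1 / Suc n" by blast
    define u where "u n \<omega> = indicat_real (sym_diff A (B (i n))) \<omega>" for n \<omega>
    have int_u: "integrable M (u n)" for n unfolding u_def by (simp add: emeasure_eq_measure)
    have "(\<lambda>n. LINT \<omega>|M. norm (u n \<omega>)) \<longlonglongrightarrow> 0"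
    proof (rule Lim_null_comparison)
      show "(\<lambda>n. 1 / real (Suc n)) \<longlonglongrightarrow> 0" using LIMSEQ_inverse_real_of_nat by (simp add: inverse_eq_divide)
      have "(LINT \<omega>|M. norm (u n \<omega>)) = measure M (sym_diff A (B (i n)))" for n by (simp add: u_def)
      then show "\<forall>\<^sub>F n in sequentially. norm (LINT \<omega>|M. norm (u n \<omega>)) \<le> 1 / Suc n"
        using less_imp_le[OF i] by simp
    qed
    from tendsto_L1_AE_subseq[OF int_u this] obtain r :: "nat \<Rightarrow> nat"
      where r: "AE \<omega> in M. (\<lambda>n. u (r n) \<omega>) \<longlonglongrightarrow> 0" by blast
    have "(\<lambda>n. LINT \<omega>|M. indicator (B (i (r n))) \<omega> * D \<omega>) \<longlonglongrightarrow> (LINT \<omega>|M. indicator A \<omega> * D \<omega>)"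
    proof (rule integral_dominated_convergence)
      show "integrable M (\<lambda>\<omega>. norm (D \<omega>))" using D by auto
      show "AE \<omega> in M. norm (indicator (B (i (r n))) \<omega> * D \<omega>) \<le> norm (D \<omega>)" for n
        by (rule AE_I2) (auto simp: indicator_def)
      show "AE \<omega> in M. (\<lambda>n. indicator (B (i (r n))) \<omega> * D \<omega>) \<longlonglongrightarrow> indicator A \<omega> * D \<omega>"
        using r
      proof eventually_elim
        fix \<omega> assume "(\<lambda>n. u (r n) \<omega>) \<longlonglongrightarrow> 0"
        then have "eventually (\<lambda>n. u (r n) \<omega> < 1) sequentially" by (rule order_tendstoD) simp
        then have "eventually (\<lambda>n. indicator (B (i (r n))) \<omega> * D \<omega> = indicator A \<omega> * D \<omega>) sequentially"
          by eventually_elim (auto simp: u_def indicator_def split: if_splits)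
        then show "(\<lambda>n. indicator (B (i (r n))) \<omega> * D \<omega>) \<longlonglongrightarrow> indicator A \<omega> * D \<omega>"
          by (rule tendsto_eventually)
      qed
    qed auto
    then show ?thesis using zero by (simp add: LIMSEQ_const_iff)
  qed
  have "AE \<omega> in M. D \<omega> \<le> 0" by (rule AE_le_if_set_integral_le[OF D]) (simp add: all)
  moreover have "AE \<omega> in M. - D \<omega> \<le> 0"
    by (rule AE_le_if_set_integral_le) (use D in \<open>auto simp: all\<close>)
  ultimately show ?thesis by eventually_elim simp
qed

context wc_correspondence
begin

lemma mid_hull_L1_weakly_convergent:
  assumes f: "\<And>k. f k \<in> sel"
  obtains g G where "g \<in> sel" "\<And>k. G k \<in> mid_hull f k"
    "AE \<omega> in M. \<forall>\<phi>. bounded_linear \<phi> \<longrightarrow> (\<lambda>k. \<phi> (G k \<omega>) :: real) \<longlonglongrightarrow> \<phi> (g \<omega>)"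
    "\<And>\<phi>. \<phi> \<in> L1_dual M \<Longrightarrow> (\<lambda>k. \<phi> (L1_class M (G k))) \<longlonglongrightarrow> \<phi> (L1_class M g)"
proof -
  obtain g G where g: "g \<in> sel" and G: "\<And>k. G k \<in> mid_hull f k"
    and conv: "AE \<omega> in M. \<forall>\<phi>. bounded_linear \<phi> \<longrightarrow> (\<lambda>k. \<phi> (G k \<omega>) :: real) \<longlonglongrightarrow> \<phi> (g \<omega>)"
    by (rule mid_hull_weakly_convergent[of f, OF f]) (rule that)
  have G_sel: "G k \<in> sel" for k by (rule mid_hull_sel[OF f G])
  have "(\<lambda>k. \<phi> (L1_class M (G k))) \<longlonglongrightarrow> \<phi> (L1_class M g)" if \<phi>: "\<phi> \<in> L1_dual M" for \<phi>
  proof -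
    obtain q C where q: "\<And>\<omega>. bounded_linear (q \<omega>)" "\<And>\<omega> y. \<bar>q \<omega> y\<bar> \<le> C * norm y"
      "\<And>f. integrable M f \<Longrightarrow> integrable M (\<lambda>\<omega>. q \<omega> (f \<omega>))"
      "\<And>f. integrable M f \<Longrightarrow> \<phi> (L1_class M f) = (LINT \<omega>|M. q \<omega> (f \<omega>))"
      by (rule L1_dual_representation[OF \<phi>]) (rule that)
    have "(\<lambda>k. LINT \<omega>|M. q \<omega> (G k \<omega>)) \<longlonglongrightarrow> (LINT \<omega>|M. q \<omega> (g \<omega>))"
    proof (rule integral_dominated_convergence)
      show "integrable M (\<lambda>\<omega>. \<bar>C\<bar> * h \<omega>)" using h(1) by auto
      show "AE \<omega> in M. (\<lambda>k. q \<omega> (G k \<omega>)) \<longlonglongrightarrow> q \<omega> (g \<omega>)"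
        using conv by eventually_elim (use q(1) in blast)
      show "AE \<omega> in M. norm (q \<omega> (G k \<omega>)) \<le> \<bar>C\<bar> * h \<omega>" for k
        using sel_bound[OF G_sel[of k]]
      proof eventually_elim
        fix \<omega> assume n: "norm (G k \<omega>) \<le> h \<omega>"
        have "norm (q \<omega> (G k \<omega>)) \<le> C * norm (G k \<omega>)" using q(2) by simp
        also have "\<dots> \<le> \<bar>C\<bar> * norm (G k \<omega>)" by (simp add: mult_right_mono)
        also have "\<dots> \<le> \<bar>C\<bar> * h \<omega>" using n by (simp add: mult_left_mono)
        finally show "norm (q \<omega> (G k \<omega>)) \<le> \<bar>C\<bar> * h \<omega>" .
      qed
    qed (use q(3)[OF sel_integrable[OF G_sel]] q(3)[OF sel_integrable[OF g]] in auto)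
    then show ?thesis by (simp add: q(4) sel_integrable G_sel g)
  qed
  with g G conv show thesis by (rule that)
qed

lemma mid_hull_functional:
  assumes f: "\<And>k. f k \<in> sel" and \<phi>: "\<phi> \<in> L1_dual M" and g: "g \<in> mid_hull f n"
    and le: "\<And>k. n \<le> k \<Longrightarrow> \<bar>\<phi> (L1_class M (f k)) - l\<bar> \<le> c"
  shows "\<bar>\<phi> (L1_class M g) - l\<bar> \<le> c"
  using g
proof (induction rule: mid_hull.induct)
  case (mid g g')
  have int: "integrable M g" "integrable M g'"
    using mid.hyps mid_hull_sel[of f, OF f] sel_integrable by blast+
  have "\<phi> (L1_class M (\<lambda>\<omega>. (1/2) *\<^sub>R (g \<omega> + g' \<omega>))) = (1/2) * (\<phi> (L1_class M g) + \<phi> (L1_class M g'))"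
    using L1_dual_scale[OF \<phi> Bochner_Integration.integrable_add[OF int]] L1_dual_add[OF \<phi> int] by simp
  with mid.IH show ?case by (simp add: abs_le_iff)
qed (rule le)

lemma countable_interpolation:
  assumes \<psi>: "\<And>k. \<psi> k \<in> L1_dual M"
    and approx: "\<And>n. \<exists>f\<in>sel. \<forall>k\<le>n. \<bar>\<psi> k (L1_class M f) - l k\<bar> \<le> 1 / Suc n"
  obtains g where "g \<in> sel" "\<And>k. \<psi> k (L1_class M g) = l k"
proof -
  obtain f where f: "\<And>n. f n \<in> sel" "\<And>n k. k \<le> n \<Longrightarrow> \<bar>\<psi> k (L1_class M (f n)) - l k\<bar> \<le> 1 / Suc n"
    using approx by metis
  have hull: "\<bar>\<psi> k (L1_class M g) - l k\<bar> \<le> 1 / Suc n" if "g \<in> mid_hull f n" "k \<le> n" for g n k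
  proof (rule mid_hull_functional[OF f(1) \<psi> that(1)])
    fix m assume m: "n \<le> m"
    have "\<bar>\<psi> k (L1_class M (f m)) - l k\<bar> \<le> 1 / Suc m" using m that(2) by (intro f(2)) simp
    also have "\<dots> \<le> 1 / Suc n" using m by (intro divide_left_mono) auto
    finally show "\<bar>\<psi> k (L1_class M (f m)) - l k\<bar> \<le> 1 / Suc n" .
  qed
  obtain g G where g: "g \<in> sel" and G: "\<And>k. G k \<in> mid_hull f k"
    and lim: "\<And>\<phi>. \<phi> \<in> L1_dual M \<Longrightarrow> (\<lambda>k. \<phi> (L1_class M (G k))) \<longlonglongrightarrow> \<phi> (L1_class M g)"
    by (rule mid_hull_L1_weakly_convergent[of f, OF f(1)]) (rule that)
  show thesis
  proof (rule that[OF g])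
    fix k
    have "(\<lambda>n. \<psi> k (L1_class M (G n)) - l k) \<longlonglongrightarrow> 0"
    proof (rule Lim_null_comparison)
      show "(\<lambda>n. 1 / real (Suc n)) \<longlonglongrightarrow> 0" using LIMSEQ_inverse_real_of_nat by (simp add: inverse_eq_divide)
      show "\<forall>\<^sub>F n in sequentially. norm (\<psi> k (L1_class M (G n)) - l k) \<le> 1 / Suc n"
        using eventually_ge_at_top[of k] by eventually_elim (use hull[OF G] in auto)
    qed
    then have "(\<lambda>n. \<psi> k (L1_class M (G n))) \<longlonglongrightarrow> l k" by (rule LIM_zero_cancel)
    then show "\<psi> k (L1_class M g) = l k" using LIMSEQ_unique[OF lim[OF \<psi>[of k]]] by simp
  qed
qed

definition sel_classes :: "('a \<Rightarrow> 'b) set set" where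
  "sel_classes = L1_class M ` sel"

lemma sel_classes_L1: "sel_classes \<subseteq> L1_space M"
  by (auto simp: sel_classes_def L1_space_def sel_integrable)

text \<open>A point of the closure of \<open>sel_classes\<close> in the space of all functionals on the dual is
  determined by a countable total family, hence \<open>countable_interpolation\<close> represents it.\<close>

lemma sel_classes_weakly_compact:
  assumes e: "\<And>k :: nat. e k \<in> L1_dual M"
    and total: "\<And>f g. f \<in> sel \<Longrightarrow> g \<in> sel \<Longrightarrow> (\<And>k. e k (L1_class M f) = e k (L1_class M g)) \<Longrightarrow>
      L1_class M f = L1_class M g"
  shows "compactin (L1_weak_topology M) sel_classes"
proof -
  define J where "J u = (\<lambda>\<phi>. if \<phi> \<in> L1_dual M then \<phi> u else (0::real))" for u :: "('a \<Rightarrow> 'b) set"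
  have inj: "inj_on J sel_classes"
  proof (rule inj_onI)
    fix u v assume "u \<in> sel_classes" "v \<in> sel_classes" and eq: "J u = J v"
    have "e k u = e k v" for k using fun_cong[OF eq, of "e k"] e by (simp add: J_def)
    with \<open>u \<in> sel_classes\<close> \<open>v \<in> sel_classes\<close> show "u = v"
      unfolding sel_classes_def using total by blast
  qed
  have "\<exists>c. \<forall>u\<in>sel_classes. \<bar>J u \<phi>\<bar> \<le> c" for \<phi>
  proof (cases "\<phi> \<in> L1_dual M")
    case True
    then obtain C where C: "\<And>f. integrable M f \<Longrightarrow> \<bar>\<phi> (L1_class M f)\<bar> \<le> C * (LINT \<omega>|M. norm (f \<omega>))"
      by (auto simp: L1_dual_def)
    have "\<bar>\<phi> (L1_class M f)\<bar> \<le> \<bar>C\<bar> * (LINT \<omega>|M. h \<omega>)" if f: "f \<in> sel" for f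
    proof -
      note C[OF sel_integrable[OF f]]
      also have "C * (LINT \<omega>|M. norm (f \<omega>)) \<le> \<bar>C\<bar> * (LINT \<omega>|M. norm (f \<omega>))"
        by (intro mult_right_mono) auto
      also have "\<dots> \<le> \<bar>C\<bar> * (LINT \<omega>|M. h \<omega>)"
        using sel_integrable[OF f] h(1) sel_bound[OF f] by (intro mult_left_mono integral_mono_AE) auto
      finally show ?thesis .
    qed
    with True show ?thesis by (auto simp: J_def sel_classes_def)
  qed (auto simp: J_def)
  then obtain c where c: "\<And>\<phi> u. u \<in> sel_classes \<Longrightarrow> \<bar>J u \<phi>\<bar> \<le> c \<phi>" by metis
  have "closed (J ` sel_classes)"
  proof -
    have "\<Phi> \<in> J ` sel_classes" if \<Phi>: "\<Phi> \<in> closure (J ` sel_classes)" for \<Phi>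
    proof -
      have near: "\<exists>u\<in>sel_classes. J u \<in> U" if "open U" "\<Phi> \<in> U" for U
        using \<Phi> that unfolding closure_iff_nhds_not_empty by blast
      have coord: "continuous_on UNIV (\<lambda>\<Psi> :: (('a \<Rightarrow> 'b) set \<Rightarrow> real) \<Rightarrow> real. \<Psi> \<phi>)" for \<phi>
        by (rule continuous_on_product_coordinates)
      have interp: "\<exists>g\<in>sel. \<forall>k. \<psi> k (L1_class M g) = \<Phi> (\<psi> k)" if \<psi>: "\<And>k. \<psi> k \<in> L1_dual M" for \<psi> :: "nat \<Rightarrow> _"
      proof -
        have "\<exists>f\<in>sel. \<forall>k\<le>n. \<bar>\<psi> k (L1_class M f) - \<Phi> (\<psi> k)\<bar> \<le> 1 / Suc n" for n
        proof -
          let ?U = "\<Inter>k\<in>{..n}. {\<Psi>. \<bar>\<Psi> (\<psi> k) - \<Phi> (\<psi> k)\<bar> < 1 / Suc n}"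
          have op: "open ?U"
            by (intro open_INT ballI open_Collect_less continuous_intros coord) auto
          have "\<Phi> \<in> ?U" by simp
          from near[OF op this] obtain u where u: "u \<in> sel_classes" "J u \<in> ?U" by (rule bexE)
          then obtain f where f: "f \<in> sel" "u = L1_class M f" by (auto simp: sel_classes_def)
          have "\<bar>\<psi> k (L1_class M f) - \<Phi> (\<psi> k)\<bar> < 1 / Suc n" if "k \<le> n" for k
            using u(2) that unfolding f(2) J_def by (simp add: \<psi>)
          then show ?thesis using f(1) by (intro bexI[of _ f]) (auto intro: less_imp_le)
        qed
        then obtain g where "g \<in> sel" "\<And>k. \<psi> k (L1_class M g) = \<Phi> (\<psi> k)"
          by (rule countable_interpolation[of \<psi> "\<lambda>k. \<Phi> (\<psi> k)", OF \<psi>]) (rule that)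
        then show ?thesis by blast
      qed
      obtain g where g: "g \<in> sel" "\<And>k. e k (L1_class M g) = \<Phi> (e k)" using interp[of e] e by blast
      have "\<Phi> \<phi> = J (L1_class M g) \<phi>" for \<phi>
      proof (cases "\<phi> \<in> L1_dual M")
        case True
        have "case_nat \<phi> e k \<in> L1_dual M" for k using True e by (cases k) auto
        then obtain g' where g': "g' \<in> sel" "\<And>k. case_nat \<phi> e k (L1_class M g') = \<Phi> (case_nat \<phi> e k)"
          using interp[of "case_nat \<phi> e"] by blast
        have "e k (L1_class M g') = e k (L1_class M g)" for k using g'(2)[of "Suc k"] g(2)[of k] by simp
        then have "L1_class M g' = L1_class M g" by (intro total g'(1) g(1))
        then show ?thesis using g'(2)[of 0] True by (simp add: J_def)
      next
        case False
        have "\<Phi> \<phi> = 0"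
        proof (rule ccontr)
          assume "\<Phi> \<phi> \<noteq> 0"
          moreover have "open {\<Psi> :: (('a \<Rightarrow> 'b) set \<Rightarrow> real) \<Rightarrow> real. \<Psi> \<phi> \<noteq> 0}"
            by (intro open_Collect_neq coord continuous_on_const)
          ultimately show False using near[of "{\<Psi>. \<Psi> \<phi> \<noteq> 0}"] False by (auto simp: J_def)
        qed
        then show ?thesis using False by (simp add: J_def)
      qed
      then have "\<Phi> = J (L1_class M g)" ..
      then show ?thesis using g(1) by (auto simp: sel_classes_def)
    qed
    then show ?thesis using closure_subset_eq by blast
  qed
  moreover have "compact (PiE UNIV (\<lambda>\<phi>. {- c \<phi> .. c \<phi>}))"
  proof -
    have "compactin (product_topology (\<lambda>\<phi>. euclidean) UNIV) (PiE UNIV (\<lambda>\<phi>. {- c \<phi> .. c \<phi>}))"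
      unfolding compactin_PiE by simp
    then show ?thesis by (simp add: euclidean_product_topology)
  qed
  moreover have "J ` sel_classes \<subseteq> PiE UNIV (\<lambda>\<phi>. {- c \<phi> .. c \<phi>})"
    using c by (auto simp: abs_le_iff) (metis minus_le_iff)
  ultimately have compact: "compact (J ` sel_classes)"
    using closed_Int_compact[of "J ` sel_classes" "PiE UNIV (\<lambda>\<phi>. {- c \<phi> .. c \<phi>})"] by (simp add: Int_absorb2)
  define R where "R = inv_into sel_classes J"
  have R: "R (J u) = u" if "u \<in> sel_classes" for u unfolding R_def by (rule inv_into_f_f[OF inj that])
  have "continuous_map (top_of_set (J ` sel_classes)) (L1_weak_topology M) R"
    unfolding L1_weak_topology_def weak_topology_on_def
  proof (rule continuous_on_generated_topo)
    fix U assume "U \<in> {{x \<in> L1_space M :: ('a \<Rightarrow> 'b) set set. \<phi> x \<in> U} |\<phi> U. \<phi> \<in> L1_dual M \<and> open U}"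
    then obtain \<phi> V where U: "U = {x \<in> L1_space M. \<phi> x \<in> V}" and \<phi>: "\<phi> \<in> L1_dual M" and V: "open V" by blast
    have "R -` U \<inter> topspace (top_of_set (J ` sel_classes)) = J ` sel_classes \<inter> {\<Psi>. \<Psi> \<phi> \<in> V}"
      using R sel_classes_L1 \<phi> by (auto simp: U J_def)
    moreover have "open {\<Psi> :: (('a \<Rightarrow> 'b) set \<Rightarrow> real) \<Rightarrow> real. \<Psi> \<phi> \<in> V}"
      using open_vimage[OF V continuous_on_product_coordinates, of \<phi>] by (simp add: vimage_def)
    ultimately show "openin (top_of_set (J ` sel_classes)) (R -` U \<inter> topspace (top_of_set (J ` sel_classes)))"
      by (auto simp: openin_open)
  next
    have "L1_space M \<in> {{x \<in> L1_space M :: ('a \<Rightarrow> 'b) set set. \<phi> x \<in> U} |\<phi> U. \<phi> \<in> L1_dual M \<and> open U}"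
      using e[of 0] by (auto intro!: exI[of _ "e 0"] exI[of _ UNIV])
    then have "L1_space M \<subseteq> \<Union> {{x \<in> L1_space M :: ('a \<Rightarrow> 'b) set set. \<phi> x \<in> U} |\<phi> U. \<phi> \<in> L1_dual M \<and> open U}"
      by (rule Union_upper)
    moreover have "R ` topspace (top_of_set (J ` sel_classes)) \<subseteq> L1_space M"
      using R sel_classes_L1 by auto
    ultimately show "R ` topspace (top_of_set (J ` sel_classes)) \<subseteq> \<Union> {{x \<in> L1_space M :: ('a \<Rightarrow> 'b) set set. \<phi> x \<in> U} |\<phi> U. \<phi> \<in> L1_dual M \<and> open U}"
      by (rule order_trans[rotated])
  qed
  moreover have "compactin (top_of_set (J ` sel_classes)) (J ` sel_classes)"
    using compact by (simp add: compactin_subtopology)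
  ultimately have "compactin (L1_weak_topology M) (R ` (J ` sel_classes))" by (rule image_compactin[rotated])
  moreover have "R ` (J ` sel_classes) = sel_classes" using R by (auto simp: image_iff)
  ultimately show ?thesis by simp
qed

lemma sel_classes_embedding:
  assumes "separable_measure M"
  obtains e :: "('a \<Rightarrow> 'b) set \<Rightarrow> nat \<Rightarrow> real"
  where "\<And>k. (\<lambda>u. e u k) \<in> L1_dual M" "inj_on e sel_classes" "compact (e ` sel_classes)"
    "\<And>U u. openin (subtopology (L1_weak_topology M) sel_classes) U \<Longrightarrow> u \<in> U \<Longrightarrow>
      \<exists>W. open W \<and> e u \<in> W \<and> (\<forall>v\<in>sel_classes. e v \<in> W \<longrightarrow> v \<in> U)"
proof -
  obtain ys :: "nat \<Rightarrow> 'b \<Rightarrow> real" where ys: "norming ys" using norming_exists by blast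
  then have bl: "bounded_linear (ys j)" for j by (simp add: norming_def)
  obtain \<C> where \<C>: "countable \<C>" "\<C> \<subseteq> sets M" "\<And>A e. A \<in> sets M \<Longrightarrow> 0 < e \<Longrightarrow> \<exists>B\<in>\<C>. measure M (sym_diff A B) < e"
    using assms unfolding separable_measure_def by blast
  have ne: "\<C> \<noteq> {}" using \<C>(3)[of "{}" 1] by auto
  define B where "B = from_nat_into \<C>"
  have B: "B i \<in> sets M" for i using from_nat_into[OF ne, of i] \<C>(2) by (auto simp: B_def)
  have dense: "\<exists>i. measure M (sym_diff A (B i)) < e" if "A \<in> sets M" "0 < e" for A e
    using \<C>(3)[OF that] from_nat_into_surj[OF \<C>(1)] unfolding B_def by metis
  define e where "e u = (\<lambda>k. set_functional M (B (fst (prod_decode k))) (ys (snd (prod_decode k))) u)"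
    for u :: "('a \<Rightarrow> 'b) set"
  have e_dual: "(\<lambda>u. e u k) \<in> L1_dual M" for k
    unfolding e_def using set_functional_dual[OF B bl] by simp
  have total: "L1_class M f = L1_class M g"
    if f: "f \<in> sel" and g: "g \<in> sel" and eq: "\<And>k. e (L1_class M f) k = e (L1_class M g) k" for f g
  proof -
    have "AE \<omega> in M. ys j (f \<omega>) - ys j (g \<omega>) = 0" for j
    proof (rule AE_zero_if_dense_set_integrals_zero[OF _ B dense])
      note int = integrable_bounded_linear[OF bl[of j] sel_integrable[OF f]]
        integrable_bounded_linear[OF bl[of j] sel_integrable[OF g]]
      show "integrable M (\<lambda>\<omega>. ys j (f \<omega>) - ys j (g \<omega>))" by (rule Bochner_Integration.integrable_diff[OF int])
      fix i
      note sf = set_functional_class[OF _ B[of i] bl[of j]]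
      have "(LINT \<omega>|M. indicator (B i) \<omega> * ys j (f \<omega>)) = (LINT \<omega>|M. indicator (B i) \<omega> * ys j (g \<omega>))"
        using eq[of "prod_encode (i, j)"] sf(2)[OF sel_integrable[OF f]] sf(2)[OF sel_integrable[OF g]]
        by (simp add: e_def)
      then show "(LINT \<omega>|M. indicator (B i) \<omega> * (ys j (f \<omega>) - ys j (g \<omega>))) = 0"
        unfolding right_diff_distrib
        using sf(1)[OF sel_integrable[OF f]] sf(1)[OF sel_integrable[OF g]]
        by (simp add: Bochner_Integration.integral_diff)
    qed
    then have "AE \<omega> in M. \<forall>j. ys j (f \<omega>) - ys j (g \<omega>) = 0" unfolding AE_all_countable ..
    then have "AE \<omega> in M. f \<omega> = g \<omega>" by eventually_elim (rule norming_eq[OF ys], simp)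
    then show ?thesis by (rule L1_class_cong)
  qed
  have inj: "inj_on e sel_classes"
  proof (rule inj_onI)
    fix u v assume uv: "u \<in> sel_classes" "v \<in> sel_classes" and eq: "e u = e v"
    then obtain f g where fg: "f \<in> sel" "u = L1_class M f" "g \<in> sel" "v = L1_class M g"
      by (auto simp: sel_classes_def)
    show "u = v" using total[OF fg(1,3)] eq unfolding fg(2,4) by simp
  qed
  have compact: "compactin (L1_weak_topology M) sel_classes"
    by (rule sel_classes_weakly_compact[of "\<lambda>k u. e u k"], rule e_dual, rule total)
  have cont: "continuous_map (L1_weak_topology M) euclidean e"
    unfolding L1_weak_topology_def
    by (intro continuous_map_sequence continuous_map_weak_topology_on e_dual)
  show thesis
  proof (rule that[OF e_dual inj])
    show "compact (e ` sel_classes)" using image_compactin[OF compact cont] by simp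
    fix U u assume U: "openin (subtopology (L1_weak_topology M) sel_classes) U" "u \<in> U"
    then obtain V where V: "openin (L1_weak_topology M) V" "U = V \<inter> sel_classes" by (auto simp: openin_subtopology)
    with U(2) have uV: "u \<in> V" "u \<in> sel_classes" by auto
    obtain W where "open W" "e u \<in> W" "\<And>v. v \<in> sel_classes \<Longrightarrow> e v \<in> W \<Longrightarrow> v \<in> V"
      by (rule compactin_embedding_nhd[OF compact cont inj V(1) uV]) (rule that)
    then show "\<exists>W. open W \<and> e u \<in> W \<and> (\<forall>v\<in>sel_classes. e v \<in> W \<longrightarrow> v \<in> U)" using V(2) by blast
  qed
qed

end

section \<open>Approximate fixed points in a sequence space\<close>

lemma tendsto_fun_iff:
  fixes X :: "nat \<Rightarrow> 'i \<Rightarrow> 'c::topological_space"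
  shows "X \<longlonglongrightarrow> x \<longleftrightarrow> (\<forall>k. (\<lambda>n. X n k) \<longlonglongrightarrow> x k)"
  by (simp add: limitin_componentwise flip: limitin_canonical_iff euclidean_product_topology)

lemma compact_unit_cube: "compact {t :: nat \<Rightarrow> real. \<forall>i. 0 \<le> t i \<and> t i \<le> 1}"
proof -
  have "compactin (product_topology (\<lambda>i::nat. euclidean) UNIV) (PiE UNIV (\<lambda>i. {0..1::real}))"
    unfolding compactin_PiE by simp
  moreover have "PiE UNIV (\<lambda>i. {0..1}) = {t :: nat \<Rightarrow> real. \<forall>i. 0 \<le> t i \<and> t i \<le> 1}"
    by auto
  ultimately show ?thesis by (simp add: euclidean_product_topology)
qed

lemma brouwer_cube_fun:
  fixes f :: "(nat \<Rightarrow> real) \<Rightarrow> nat \<Rightarrow> real" and m :: nat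
  defines "Q \<equiv> {t :: nat \<Rightarrow> real. \<forall>i. 0 \<le> t i \<and> t i \<le> 1}"
  assumes cont: "\<And>i. i < m \<Longrightarrow> continuous_on Q (\<lambda>t. f t i)"
    and maps: "\<And>t i. t \<in> Q \<Longrightarrow> i < m \<Longrightarrow> 0 \<le> f t i \<and> f t i \<le> 1"
  obtains t where "t \<in> Q" "\<And>i. i < m \<Longrightarrow> f t i = t i"
proof -
  define P where "P n x = (\<lambda>i. if i < m then real (x i) / real (Suc n) else 0)" for n and x :: "nat \<Rightarrow> nat"
  have PQ: "P n x \<in> Q" if "\<forall>i<m. x i \<le> Suc n" for n x
    using that by (auto simp: P_def Q_def divide_le_eq_1)
  define R where "R n q i u v \<longleftrightarrow> u \<in> Q \<and> v \<in> Q \<and> u i \<le> f u i \<and> f v i \<le> v i \<and>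
      (\<forall>j. \<bar>u j - P n q j\<bar> \<le> 1 / Suc n) \<and> (\<forall>j. \<bar>v j - P n q j\<bar> \<le> 1 / Suc n)" for n q i u v
  have ex: "\<exists>q. (\<forall>i<m. q i < Suc n) \<and> (\<forall>i<m. \<exists>u v. R n q i u v)" for n
  proof -
    define lab where "lab x i = (if x i = Suc n then 1 else if P n x i \<le> f (P n x) i then 0 else 1 :: nat)" for x i
    have lab0: "P n x i \<le> f (P n x) i" if "lab x i = 0" for x i
      using that by (auto simp: lab_def split: if_splits)
    have lab1: "f (P n x) i \<le> P n x i" if "lab x i \<noteq> 0" "i < m" "\<forall>i<m. x i \<le> Suc n" for x i
      using that maps[OF PQ[OF that(3)] that(2)] by (auto simp: lab_def P_def split: if_splits)
    have lab_0: "lab x i = 0" if "x i = 0" "i < m" "\<forall>i<m. x i \<le> Suc n" for x i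
      using that maps[OF PQ[OF that(3)] that(2)] by (auto simp: lab_def P_def)
    obtain q where q: "\<forall>i<m. q i < Suc n"
      "\<forall>i<m. \<exists>r s. (\<forall>j<m. q j \<le> r j \<and> r j \<le> q j + 1) \<and> (\<forall>j<m. q j \<le> s j \<and> s j \<le> q j + 1) \<and> lab r i \<noteq> lab s i"
      by (rule kuhn_lemma[of "Suc n" m lab]) (use lab_0 in \<open>auto simp: lab_def\<close>)
    have "\<exists>u v. R n q i u v" if i: "i < m" for i
    proof -
      have near: "(\<forall>i<m. r i \<le> Suc n) \<and> (\<forall>j. \<bar>P n r j - P n q j\<bar> \<le> 1 / Suc n)"
        if "\<forall>j<m. q j \<le> r j \<and> r j \<le> q j + 1" for r
      proof (intro conjI allI impI)
        show "r i \<le> Suc n" if "i < m" for i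
          using that \<open>\<forall>j<m. q j \<le> r j \<and> r j \<le> q j + 1\<close> q(1) by (metis Suc_eq_plus1 Suc_leI order_trans Suc_le_mono less_Suc_eq_le)
        show "\<bar>P n r j - P n q j\<bar> \<le> 1 / Suc n" for j
        proof (cases "j < m")
          case True
          with that have "\<bar>real (r j) - real (q j)\<bar> \<le> 1" by force
          then have "\<bar>real (r j) - real (q j)\<bar> / Suc n \<le> 1 / Suc n" by (rule divide_right_mono) simp
          then show ?thesis using True by (simp add: P_def diff_divide_distrib[symmetric])
        qed (simp add: P_def)
      qed
      from q(2) i obtain r s where rs: "\<forall>j<m. q j \<le> r j \<and> r j \<le> q j + 1"
        "\<forall>j<m. q j \<le> s j \<and> s j \<le> q j + 1" "lab r i \<noteq> lab s i" by blast
      then have "\<exists>r s. (\<forall>j<m. q j \<le> r j \<and> r j \<le> q j + 1) \<and> (\<forall>j<m. q j \<le> s j \<and> s j \<le> q j + 1)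
        \<and> lab r i = 0 \<and> lab s i \<noteq> 0"
        by (cases "lab r i = 0") (metis, metis lab_def)
      then obtain r s where rs: "\<forall>j<m. q j \<le> r j \<and> r j \<le> q j + 1"
        "\<forall>j<m. q j \<le> s j \<and> s j \<le> q j + 1" "lab r i = 0" "lab s i \<noteq> 0" by blast
      show ?thesis
        using near[OF rs(1)] near[OF rs(2)] lab0[OF rs(3)] lab1[OF rs(4) i] PQ
        unfolding R_def by (intro exI[of _ "P n r"] exI[of _ "P n s"]) simp
    qed
    with q(1) show ?thesis by blast
  qed
  from ex obtain q where q: "\<And>n i. i < m \<Longrightarrow> q n i < Suc n"
    and "\<forall>n i. \<exists>u v. i < m \<longrightarrow> R n (q n) i u v"
    by metis
  then obtain u v where "\<And>n i. i < m \<Longrightarrow> R n (q n) i (u n i) (v n i)"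
    by metis
  then have uv: "\<And>n i. i < m \<Longrightarrow> u n i \<in> Q" "\<And>n i. i < m \<Longrightarrow> v n i \<in> Q"
      "\<And>n i. i < m \<Longrightarrow> u n i i \<le> f (u n i) i" "\<And>n i. i < m \<Longrightarrow> f (v n i) i \<le> v n i i"
      "\<And>n i j. i < m \<Longrightarrow> \<bar>u n i j - P n (q n) j\<bar> \<le> 1 / Suc n"
      "\<And>n i j. i < m \<Longrightarrow> \<bar>v n i j - P n (q n) j\<bar> \<le> 1 / Suc n"
    unfolding R_def by blast+
  have "\<forall>n. P n (q n) \<in> Q"
    by (intro allI PQ) (use q less_imp_le in blast)
  moreover have "seq_compact Q"
    using compact_unit_cube unfolding Q_def compact_eq_seq_compact_metric .
  ultimately obtain t r where t: "t \<in> Q" "strict_mono r" "((\<lambda>n. P n (q n)) \<circ> r) \<longlonglongrightarrow> t"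
    using seq_compactE[of Q "\<lambda>n. P n (q n)"] by metis
  have conv: "(\<lambda>n. w (r n)) \<longlonglongrightarrow> t" if w: "\<And>n j. \<bar>w n j - P n (q n) j\<bar> \<le> 1 / Suc n" for w
    unfolding tendsto_fun_iff
  proof
    fix j
    have "(\<lambda>n. w (r n) j - P (r n) (q (r n)) j) \<longlonglongrightarrow> 0"
    proof (rule Lim_null_comparison)
      show "(\<lambda>n. 1 / Suc (r n)) \<longlonglongrightarrow> 0"
        using LIMSEQ_subseq_LIMSEQ[OF LIMSEQ_inverse_real_of_nat t(2)] by (simp add: o_def inverse_eq_divide)
      show "\<forall>\<^sub>F n in sequentially. norm (w (r n) j - P (r n) (q (r n)) j) \<le> 1 / Suc (r n)"
        using w by simp
    qed
    moreover have "(\<lambda>n. P (r n) (q (r n)) j) \<longlonglongrightarrow> t j" 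
      using t(3)[unfolded tendsto_fun_iff] by (auto simp: o_def)
    ultimately have "(\<lambda>n. (w (r n) j - P (r n) (q (r n)) j) + P (r n) (q (r n)) j) \<longlonglongrightarrow> 0 + t j"
      by (rule tendsto_add)
    then show "(\<lambda>n. w (r n) j) \<longlonglongrightarrow> t j" by simp
  qed
  show thesis
  proof (rule that[OF t(1)])
    fix i assume i: "i < m"
    have lim: "(\<lambda>n. f (w (r n)) i) \<longlonglongrightarrow> f t i \<and> (\<lambda>n. w (r n) i) \<longlonglongrightarrow> t i"
      if w: "\<And>n j. \<bar>w n j - P n (q n) j\<bar> \<le> 1 / Suc n" "\<And>n. w n \<in> Q" for w
      using continuous_on_tendsto_compose[OF cont[OF i] conv[OF w(1)] t(1)] w(2) conv[OF w(1), unfolded tendsto_fun_iff]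
      by auto
    have "t i \<le> f t i"
      using lim[of "\<lambda>n. u n i"] uv i by (intro LIMSEQ_le[of "\<lambda>n. u (r n) i i" _ "\<lambda>n. f (u (r n) i) i"]) auto
    moreover have "f t i \<le> t i"
      using lim[of "\<lambda>n. v n i"] uv i by (intro LIMSEQ_le[of "\<lambda>n. f (v (r n) i) i" _ "\<lambda>n. v (r n) i i"]) auto
    ultimately show "f t i = t i" by simp
  qed
qed

text \<open>Brouwer's theorem is applied to the weights of a partition of unity subordinate to a finite
  cover of \<open>E\<close> by \<open>e\<close>-balls; points of the cube are first moved into the simplex.\<close>

lemma approximate_fixed_combination:
  fixes E :: "(nat \<Rightarrow> real) set"
  assumes E: "compact E" "E \<noteq> {}"
    and conv: "\<And>m t y. (\<And>i. i < m \<Longrightarrow> 0 \<le> t i) \<Longrightarrow> (\<Sum>i<m. t i) = 1 \<Longrightarrow> (\<And>i. i < m \<Longrightarrow> y i \<in> E) \<Longrightarrow>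
      (\<lambda>k. \<Sum>i<(m::nat). t i * y i k) \<in> E"
    and \<psi>: "\<And>x. x \<in> E \<Longrightarrow> \<psi> x \<in> E" and e: "0 < e"
  obtains m :: nat and t x where "\<And>i. i < m \<Longrightarrow> 0 \<le> t i" "(\<Sum>i<m. t i) = 1" "\<And>i. i < m \<Longrightarrow> x i \<in> E"
    "\<And>i. i < m \<Longrightarrow> 0 < t i \<Longrightarrow> dist (x i) (\<lambda>k. \<Sum>i<m. t i * \<psi> (x i) k) < e"
proof -
  obtain C where C: "C \<subseteq> E" "finite C" "E \<subseteq> (\<Union>c\<in>C. ball c e)"
    using compactE_image[OF E(1), of E "\<lambda>c. ball c e"] e by force
  then obtain x and m :: nat where x: "C = x ` {..<m}"
    using finite_imp_nat_seg_image_inj_on[OF C(2)] by (auto simp: lessThan_def)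
  have xE: "x i \<in> E" if "i < m" for i using that C(1) x by auto
  have m: "m > 0" using C(3) E(2) x by (cases m) auto
  define Q where "Q = {t :: nat \<Rightarrow> real. \<forall>i. 0 \<le> t i \<and> t i \<le> 1}"
  define S where "S t = (\<Sum>j<m. t j)" for t :: "nat \<Rightarrow> real"
  define w where "w t i = t i / max 1 (S t) + (1 - S t / max 1 (S t)) / m" for t i
  define y where "y t = (\<lambda>k. \<Sum>i<m. w t i * \<psi> (x i) k)" for t
  define g where "g t i = max 0 (e - dist (x i) (y t))" for t i
  have w_nonneg: "0 \<le> w t i" if "t \<in> Q" for t i
    using that unfolding w_def Q_def by (intro add_nonneg_nonneg divide_nonneg_nonneg) (auto simp: divide_le_eq_1)
  have w_sum: "(\<Sum>i<m. w t i) = 1" for t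
    using m by (simp add: w_def sum.distrib sum_divide_distrib[symmetric] S_def[symmetric])
  have yE: "y t \<in> E" if "t \<in> Q" for t
    unfolding y_def by (rule conv[OF w_nonneg[OF that] w_sum]) (use \<psi> xE in auto)
  have coord: "continuous_on Q (\<lambda>t. t i :: real)" for i
    by (rule continuous_on_subset[OF continuous_on_product_coordinates]) simp
  have y_cont: "continuous_on Q y"
    unfolding y_def w_def S_def
    by (intro continuous_on_coordinatewise_then_product continuous_intros coord continuous_on_max) auto
  have g_cont: "continuous_on Q (\<lambda>t. g t i)" for i
    unfolding g_def by (intro continuous_intros continuous_on_max y_cont)
  have g_nonneg: "0 \<le> g t i" for t i by (simp add: g_def)
  have G_pos: "0 < (\<Sum>i<m. g t i)" if "t \<in> Q" for t
  proof -
    have "y t \<in> E" by (rule yE[OF that])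
    then obtain i where "i < m" "dist (x i) (y t) < e" using C(3) x by auto
    then show ?thesis by (intro sum_pos2[of _ i] g_nonneg) (auto simp: g_def)
  qed
  have le: "g t i \<le> (\<Sum>i<m. g t i)" if "i < m" for t i
    by (rule member_le_sum) (use that g_nonneg in auto)
  obtain t where t: "t \<in> Q" "\<And>i. i < m \<Longrightarrow> g t i / (\<Sum>i<m. g t i) = t i"
  proof (rule brouwer_cube_fun[of m "\<lambda>t i. g t i / (\<Sum>i<m. g t i)", folded Q_def])
    show "continuous_on Q (\<lambda>t. g t i / (\<Sum>i<m. g t i))" for i
      by (intro continuous_intros g_cont) (use G_pos in force)
    show "0 \<le> g t i / (\<Sum>i<m. g t i) \<and> g t i / (\<Sum>i<m. g t i) \<le> 1" if "t \<in> Q" "i < m" for t i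
      using G_pos[OF that(1)] le[OF that(2)] g_nonneg by (simp add: divide_le_eq_1)
  qed (rule that)
  have "S t = (\<Sum>i<m. g t i / (\<Sum>i<m. g t i))" unfolding S_def using t(2) by simp
  also have "\<dots> = 1" using G_pos[OF t(1)] by (simp add: sum_divide_distrib[symmetric])
  finally have St: "S t = 1" .
  then have wt: "w t = t" by (auto simp: w_def)
  show thesis
  proof (rule that[of m t x])
    show "(\<Sum>i<m. t i) = 1" using St by (simp add: S_def)
    show "0 \<le> t i" for i using t(1) by (simp add: Q_def)
    show "dist (x i) (\<lambda>k. \<Sum>i<m. t i * \<psi> (x i) k) < e" if "i < m" "0 < t i" for i
    proof -
      have "g t i \<noteq> 0" using t(2)[OF that(1)] that(2) by auto
      then show ?thesis by (auto simp: g_def y_def wt split: if_splits)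
    qed
  qed (rule xE)
qed

section \<open>Fixed points of random correspondences\<close>

lemma convex_infdist_less:
  fixes C :: "'b::real_normed_vector set"
  assumes "convex C"
  shows "convex {y. infdist y C < e}"
proof (rule convexI)
  fix x y and u v :: real
  assume xy: "x \<in> {y. infdist y C < e}" "y \<in> {y. infdist y C < e}" and uv: "0 \<le> u" "0 \<le> v" "u + v = 1"
  have "infdist (u *\<^sub>R x + v *\<^sub>R y) C \<le> u * infdist x C + v * infdist y C"
    using convex_infdist[OF assms] uv by (auto simp: convex_on_def)
  also have "\<dots> < e" using xy uv by (intro convex_bound_lt) auto
  finally show "u *\<^sub>R x + v *\<^sub>R y \<in> {y. infdist y C < e}" by simp
qed

lemma convex_combination_in:
  fixes y :: "nat \<Rightarrow> 'b::real_vector"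
  assumes C: "convex C" and t: "\<And>i. i < m \<Longrightarrow> 0 \<le> t i" "(\<Sum>i<m. t i) = 1"
    and y: "\<And>i. i < m \<Longrightarrow> 0 < t i \<Longrightarrow> y i \<in> C"
  shows "(\<Sum>i<m. t i *\<^sub>R y i) \<in> C"
proof -
  let ?I = "{i\<in>{..<m}. 0 < t i}"
  have zero: "t i = 0" if "i \<in> {..<m} - ?I" for i using that t(1)[of i] by auto
  have "(\<Sum>i\<in>?I. t i) = (\<Sum>i<m. t i)"
    by (rule sum.mono_neutral_left) (simp, blast, intro ballI zero)
  then have "(\<Sum>i\<in>?I. t i *\<^sub>R y i) \<in> C" by (intro convex_sum[OF _ C]) (simp_all add: t(2) y)
  also have "(\<Sum>i\<in>?I. t i *\<^sub>R y i) = (\<Sum>i<m. t i *\<^sub>R y i)"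
    by (rule sum.mono_neutral_left) (simp, blast, intro ballI, simp only: zero scaleR_zero_left)
  finally show ?thesis .
qed

context wc_correspondence
begin

lemma sel_convex_combination:
  assumes t: "\<And>i. i < m \<Longrightarrow> 0 \<le> t i" "(\<Sum>i<m. t i) = 1" and f: "\<And>i. i < m \<Longrightarrow> f i \<in> sel"
  shows "(\<lambda>\<omega>. \<Sum>i<(m::nat). t i *\<^sub>R f i \<omega>) \<in> sel"
proof -
  have "(\<lambda>\<omega>. \<Sum>i<m. t i *\<^sub>R f i \<omega>) \<in> borel_measurable M"
    by (intro borel_measurable_sum borel_measurable_scaleR borel_measurable_const) (use f sel_measurable in auto)
  moreover have "AE \<omega> in M. \<forall>i\<in>{..<m}. f i \<omega> \<in> K \<omega>"
    by (rule AE_finite_allI) (use f sel_in in auto)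
  then have "AE \<omega> in M. (\<Sum>i<m. t i *\<^sub>R f i \<omega>) \<in> K \<omega>"
    using AE_space by eventually_elim (intro convex_combination_in K_convex t, auto)
  ultimately show ?thesis by (simp add: sel_def)
qed

lemma measurable_selection_sel:
  assumes "lower_measurable M T" "\<And>\<omega>. \<omega> \<in> space M \<Longrightarrow> T \<omega> \<noteq> {} \<and> T \<omega> \<subseteq> K \<omega>"
  obtains s where "s \<in> sel" "\<And>\<omega>. \<omega> \<in> space M \<Longrightarrow> s \<omega> \<in> closure (T \<omega>)"
proof -
  obtain s where s: "s \<in> borel_measurable M" "\<And>\<omega>. \<omega> \<in> space M \<Longrightarrow> s \<omega> \<in> closure (T \<omega>)"
    using measurable_selection[OF assms(1)] assms(2) by metis
  have "s \<omega> \<in> K \<omega>" if "\<omega> \<in> space M" for \<omega>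
    using s(2)[OF that] closure_minimal[OF _ weak_compact_closed[OF K_compact[OF that]]] assms(2)[OF that] by blast
  then have "s \<in> sel" using s(1) by (auto simp: sel_def)
  then show thesis using s(2) by (rule that)
qed

text \<open>Approximate fixed points \<open>f n\<close>, convex combinations of selections of \<open>C\<close> at points close to
  the class of \<open>f n\<close>, accumulate weakly at some \<open>u\<close>. By upper semicontinuity \<open>f n \<omega>\<close> eventually lies in
  any given neighbourhood of the convex set \<open>C \<omega> u\<close>, and so do the values of forward midpoint
  combinations, which converge weakly to a representative of \<open>u\<close>.\<close>

theorem random_fixed_point:
  fixes C :: "'a \<Rightarrow> ('a \<Rightarrow> 'b) set \<Rightarrow> 'b set"
  assumes sep: "separable_measure M"
    and K: "lower_measurable M K" "\<And>\<omega>. \<omega> \<in> space M \<Longrightarrow> K \<omega> \<noteq> {}"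
    and C_meas: "\<And>u. u \<in> sel_classes \<Longrightarrow> lower_measurable M (\<lambda>\<omega>. C \<omega> u)"
    and C: "\<And>\<omega> u. \<omega> \<in> space M \<Longrightarrow> u \<in> sel_classes \<Longrightarrow> C \<omega> u \<noteq> {} \<and> C \<omega> u \<subseteq> K \<omega> \<and> convex (C \<omega> u)"
    and usc: "\<And>\<omega> V. \<omega> \<in> space M \<Longrightarrow> open V \<Longrightarrow>
      openin (subtopology (L1_weak_topology M) sel_classes) {u \<in> sel_classes. closure (C \<omega> u) \<subseteq> V}"
  shows "\<exists>u\<in>sel_classes. \<forall>f\<in>u. AE \<omega> in M. f \<omega> \<in> closure (C \<omega> u)"
proof -
  obtain e :: "('a \<Rightarrow> 'b) set \<Rightarrow> nat \<Rightarrow> real" where e: "\<And>k. (\<lambda>u. e u k) \<in> L1_dual M"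
    and inj: "inj_on e sel_classes" and compact: "compact (e ` sel_classes)"
    and nhd: "\<And>U u. openin (subtopology (L1_weak_topology M) sel_classes) U \<Longrightarrow> u \<in> U \<Longrightarrow>
      \<exists>W. open W \<and> e u \<in> W \<and> (\<forall>v\<in>sel_classes. e v \<in> W \<longrightarrow> v \<in> U)"
    by (rule sel_classes_embedding[OF sep]) (rule that)
  have class_sel: "L1_class M f \<in> sel_classes" if "f \<in> sel" for f using that by (simp add: sel_classes_def)
  have "\<exists>s. s \<in> sel \<and> (\<forall>\<omega>\<in>space M. s \<omega> \<in> closure (C \<omega> u))" if u: "u \<in> sel_classes" for u
    by (rule measurable_selection_sel[OF C_meas[OF u]]) (use C[OF _ u] in blast)+
  then obtain s where s: "\<And>u. u \<in> sel_classes \<Longrightarrow> s u \<in> sel"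
    "\<And>u \<omega>. u \<in> sel_classes \<Longrightarrow> \<omega> \<in> space M \<Longrightarrow> s u \<omega> \<in> closure (C \<omega> u)"
    by metis
  define \<psi> where "\<psi> x = e (L1_class M (s (inv_into sel_classes e x)))" for x
  have comb: "e (L1_class M (\<lambda>\<omega>. \<Sum>i<m. t i *\<^sub>R f i \<omega>)) = (\<lambda>k. \<Sum>i<m. t i * e (L1_class M (f i)) k)"
    if "\<And>i. i < m \<Longrightarrow> f i \<in> sel" for m :: nat and t f
    using L1_dual_sum[OF e, of m f] sel_integrable that by (auto simp: fun_eq_iff)
  define near where "near n f v t m \<longleftrightarrow> (\<forall>i<m. v i \<in> sel_classes \<and> 0 \<le> t i \<and>
        (0 < t i \<longrightarrow> dist (e (v i)) (e (L1_class M f)) < 1 / Suc n)) \<and>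
      (\<Sum>i<m. t i) = 1 \<and> f = (\<lambda>\<omega>. \<Sum>i<m. t i *\<^sub>R s (v i) \<omega>)" for n f v t and m :: nat
  have "\<exists>f v t m. near n f v t m" for n
  proof -
    obtain m :: nat and t x where mtx: "\<And>i. i < m \<Longrightarrow> 0 \<le> t i" "(\<Sum>i<m. t i) = 1"
      "\<And>i. i < m \<Longrightarrow> x i \<in> e ` sel_classes"
      "\<And>i. i < m \<Longrightarrow> 0 < t i \<Longrightarrow> dist (x i) (\<lambda>k. \<Sum>i<m. t i * \<psi> (x i) k) < 1 / Suc n"
    proof (rule approximate_fixed_combination[OF compact])
      obtain s0 where "s0 \<in> sel" by (rule measurable_selection_sel[OF K(1)]) (use K(2) in auto)
      then show "e ` sel_classes \<noteq> {}" using class_sel by blast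
      show "0 < 1 / real (Suc n)" by simp
      show "\<psi> x \<in> e ` sel_classes" if "x \<in> e ` sel_classes" for x
        unfolding \<psi>_def by (intro imageI class_sel s inv_into_into that)
      show "(\<lambda>k. \<Sum>i<m. t i * y i k) \<in> e ` sel_classes"
        if t: "\<And>i. i < m \<Longrightarrow> 0 \<le> t i" "(\<Sum>i<m. t i) = 1" and y: "\<And>i. i < m \<Longrightarrow> y i \<in> e ` sel_classes"
        for m :: nat and t y
      proof -
        have "\<exists>f. i < m \<longrightarrow> f \<in> sel \<and> y i = e (L1_class M f)" for i
          using y[of i] by (auto simp: sel_classes_def)
        then obtain f where f: "\<And>i. i < m \<Longrightarrow> f i \<in> sel" "\<And>i. i < m \<Longrightarrow> y i = e (L1_class M (f i))" by metis
        have "(\<lambda>k. \<Sum>i<m. t i * y i k) = e (L1_class M (\<lambda>\<omega>. \<Sum>i<m. t i *\<^sub>R f i \<omega>))"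
          using comb[of m f t, OF f(1)] f(2) by simp
        then show ?thesis using class_sel[OF sel_convex_combination[OF t f(1)]] by simp
      qed
    qed (rule that)
    define v where "v i = inv_into sel_classes e (x i)" for i
    have v: "v i \<in> sel_classes" "e (v i) = x i" if "i < m" for i
      unfolding v_def using mtx(3)[OF that] by (auto intro: inv_into_into f_inv_into_f)
    have "e (L1_class M (\<lambda>\<omega>. \<Sum>i<m. t i *\<^sub>R s (v i) \<omega>)) = (\<lambda>k. \<Sum>i<m. t i * \<psi> (x i) k)"
      using comb[of m "\<lambda>i. s (v i)" t] s(1) v(1) by (simp add: \<psi>_def v_def)
    with mtx v show ?thesis
      unfolding near_def by (intro exI[of _ "\<lambda>\<omega>. \<Sum>i<m. t i *\<^sub>R s (v i) \<omega>"] exI[of _ v] exI[of _ t] exI[of _ m]) simp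
  qed
  then obtain f v t m where "\<And>n. near n (f n) (v n) (t n) (m n)" by metis
  then have v: "\<And>n i. i < m n \<Longrightarrow> v n i \<in> sel_classes" and t: "\<And>n i. i < m n \<Longrightarrow> 0 \<le> t n i" "\<And>n. (\<Sum>i<m n. t n i) = 1"
    and close: "\<And>n i. i < m n \<Longrightarrow> 0 < t n i \<Longrightarrow> dist (e (v n i)) (e (L1_class M (f n))) < 1 / Suc n"
    and f: "\<And>n. f n = (\<lambda>\<omega>. \<Sum>i<m n. t n i *\<^sub>R s (v n i) \<omega>)"
    unfolding near_def by blast+
  have f_sel: "f n \<in> sel" for n
    unfolding f by (intro sel_convex_combination t s v)
  have "\<forall>n. e (L1_class M (f n)) \<in> e ` sel_classes" using class_sel[OF f_sel] by blast
  moreover have "seq_compact (e ` sel_classes)" using compact compact_eq_seq_compact_metric by blast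
  ultimately obtain x r where x: "x \<in> e ` sel_classes" and r: "strict_mono r"
    and lim: "((\<lambda>n. e (L1_class M (f n))) \<circ> r) \<longlonglongrightarrow> x"
    using seq_compactE[of "e ` sel_classes" "\<lambda>n. e (L1_class M (f n))"] by metis
  obtain u where u: "u \<in> sel_classes" "x = e u" using x by blast
  define F where "F n = f (r n)" for n
  have lim_F: "(\<lambda>n. e (L1_class M (F n))) \<longlonglongrightarrow> e u" using lim by (simp add: u(2) F_def o_def)
  have F_sel: "F n \<in> sel" for n using f_sel by (simp add: F_def)
  obtain g G where g: "g \<in> sel" and G: "\<And>k. G k \<in> mid_hull F k"
    and conv: "AE \<omega> in M. \<forall>\<phi>. bounded_linear \<phi> \<longrightarrow> (\<lambda>k. \<phi> (G k \<omega>) :: real) \<longlonglongrightarrow> \<phi> (g \<omega>)"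
    and lim_G: "\<And>\<phi>. \<phi> \<in> L1_dual M \<Longrightarrow> (\<lambda>k. \<phi> (L1_class M (G k))) \<longlonglongrightarrow> \<phi> (L1_class M g)"
    by (rule mid_hull_L1_weakly_convergent[of F, OF F_sel]) (rule that)
  have "e (L1_class M g) k = e u k" for k
  proof (rule LIMSEQ_unique[OF lim_G[OF e]], rule metric_LIMSEQ_I)
    fix c :: real assume c: "0 < c"
    have "(\<lambda>n. e (L1_class M (F n)) k) \<longlonglongrightarrow> e u k" using lim_F[unfolded tendsto_fun_iff] by blast
    from metric_LIMSEQ_D[OF this, of "c/2"] c
    obtain N where N: "\<And>n. N \<le> n \<Longrightarrow> \<bar>e (L1_class M (F n)) k - e u k\<bar> < c / 2" by (auto simp: dist_real_def)
    have "\<bar>e (L1_class M (G n)) k - e u k\<bar> \<le> c / 2" if "N \<le> n" for n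
      by (rule mid_hull_functional[of F, OF F_sel e G]) (use N that less_imp_le order_trans in blast)
    then show "\<exists>N. \<forall>n\<ge>N. dist (e (L1_class M (G n)) k) (e u k) < c"
      using c by (intro exI[of _ N]) (force simp: dist_real_def)
  qed
  then have "e (L1_class M g) = e u" ..
  then have u_g: "u = L1_class M g" using inj_onD[OF inj _ class_sel[OF g] u(1)] by simp
  have "AE \<omega> in M. g \<omega> \<in> closure (C \<omega> u)"
    using conv AE_space
  proof eventually_elim
    fix \<omega> assume wk: "\<forall>\<phi>. bounded_linear \<phi> \<longrightarrow> (\<lambda>k. \<phi> (G k \<omega>) :: real) \<longlonglongrightarrow> \<phi> (g \<omega>)"
      and \<omega>: "\<omega> \<in> space M"
    note C_u = C[OF \<omega> u(1)]
    have "infdist (g \<omega>) (C \<omega> u) \<le> c" if c: "0 < c" for c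
    proof -
      define V where "V = {y. infdist y (C \<omega> u) < c}"
      have "open V" unfolding V_def by (intro open_Collect_less continuous_intros)
      have "convex V" unfolding V_def using C_u by (intro convex_infdist_less) simp
      have "closure (C \<omega> u) \<subseteq> V" using c by (auto simp: V_def in_closure_iff_infdist_zero[OF conjunct1[OF C_u]])
      then obtain W where W: "open W" "e u \<in> W" "\<And>v. v \<in> sel_classes \<Longrightarrow> e v \<in> W \<Longrightarrow> closure (C \<omega> v) \<subseteq> V"
        using nhd[OF usc[OF \<omega> \<open>open V\<close>], of u] u(1) by blast
      obtain d where d: "d > 0" "ball (e u) d \<subseteq> W" using W(1,2) open_contains_ball by blast
      have "eventually (\<lambda>n. dist (e (L1_class M (F n))) (e u) < d / 2) sequentially"
        using tendstoD[OF lim_F, of "d/2"] d by simp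
      moreover have "eventually (\<lambda>n. 1 / real (Suc n) < d / 2) sequentially"
        using order_tendstoD(2)[OF LIMSEQ_inverse_real_of_nat, of "d/2"] d by (simp add: inverse_eq_divide)
      ultimately have "eventually (\<lambda>n. F n \<omega> \<in> V) sequentially"
      proof eventually_elim
        fix n assume n: "dist (e (L1_class M (F n))) (e u) < d / 2" "1 / real (Suc n) < d / 2"
        show "F n \<omega> \<in> V"
          unfolding F_def f
        proof (rule convex_combination_in[OF \<open>convex V\<close> t])
          fix i assume i: "i < m (r n)" "0 < t (r n) i"
          have "1 / real (Suc (r n)) \<le> 1 / real (Suc n)"
            using seq_suble[OF r, of n] by (intro divide_left_mono) auto
          then have "dist (e (v (r n) i)) (e u) < d"
            using close[OF i] n dist_triangle[of "e (v (r n) i)" "e u" "e (L1_class M (F n))"] by (simp add: F_def)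
          then have "e (v (r n) i) \<in> W" using d by (auto simp: dist_commute)
          then show "s (v (r n) i) \<omega> \<in> V" using W(3)[OF v[OF i(1)]] s(2)[OF v[OF i(1)] \<omega>] by blast
        qed
      qed
      then obtain N where N: "\<And>n. N \<le> n \<Longrightarrow> F n \<omega> \<in> V" by (auto simp: eventually_sequentially)
      have "G n \<omega> \<in> V" if "N \<le> n" for n
        by (rule mid_hull_convex[OF G \<open>convex V\<close>]) (use N that order_trans in blast)
      then have "eventually (\<lambda>n. infdist (G n \<omega>) (C \<omega> u) \<le> c) sequentially"
        by (intro eventually_sequentiallyI[of N]) (simp add: V_def less_imp_le)
      then show ?thesis using C_u wk by (intro infdist_weak_lsc[of "C \<omega> u" "\<lambda>n. G n \<omega>"]) auto
    qed
    then have "infdist (g \<omega>) (C \<omega> u) = 0"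
      using field_le_epsilon[of "infdist (g \<omega>) (C \<omega> u)" 0] infdist_nonneg[of "g \<omega>" "C \<omega> u"] by simp
    then show "g \<omega> \<in> closure (C \<omega> u)" using C_u by (simp add: in_closure_iff_infdist_zero)
  qed
  then have "AE \<omega> in M. f \<omega> \<in> closure (C \<omega> u)" if "f \<in> u" for f
    using that unfolding u_g L1_class_def by (auto elim: eventually_elim2)
  with u(1) show ?thesis by blast
qed

end

theorem theorem6:
  fixes M :: "'a measure"
    and X :: "'a \<Rightarrow> 'b::{banach, second_countable_topology} \<Rightarrow> real"
    and A :: "'a \<times> ('a \<Rightarrow> 'b) set \<Rightarrow> 'b \<Rightarrow> real"
    and a :: "('a \<Rightarrow> 'b) set \<Rightarrow> real"
    and z :: real
  assumes "complete_measure M" and "finite_measure M" and "separable_measure M"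
    and z: "0 < z" "z \<le> 1"
    and X: "fuzzy_mapping (space M) X"
    and A: "random_fuzzy_mapping M (L_sel M X z) A"
    and a: "\<And>u. u \<in> L_sel M X z \<Longrightarrow> 0 < a u \<and> a u \<le> 1"
    and A_sub_X: "\<And>\<omega> u. \<omega> \<in> space M \<Longrightarrow> u \<in> L_sel M X z \<Longrightarrow>
      level_cut (A (\<omega>, u)) (a u) \<subseteq> level_cut (X \<omega>) z"
    and A1a: "\<And>\<omega>. \<omega> \<in> space M \<Longrightarrow>
      level_cut (X \<omega>) z \<noteq> {} \<and> convex (level_cut (X \<omega>) z) \<and> compactin weak_topology (level_cut (X \<omega>) z)"
      "integrably_bounded M (\<lambda>\<omega>. level_cut (X \<omega>) z)"
    and A1b: "lower_measurable M (\<lambda>\<omega>. level_cut (X \<omega>) z)"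
    and A2a: "\<And>\<omega> u. \<omega> \<in> space M \<Longrightarrow> u \<in> L_sel M X z \<Longrightarrow>
      convex (level_cut (A (\<omega>, u)) (a u)) \<and>
      (top_of_set (level_cut (X \<omega>) z)) interior_of (level_cut (A (\<omega>, u)) (a u)) \<noteq> {}"
    and A2b: "{(\<omega>, u, y). \<omega> \<in> space M \<and> u \<in> L_sel M X z \<and> y \<in> level_cut (A (\<omega>, u)) (a u)}
      \<in> sets (M \<Otimes>\<^sub>M L_sel_borel M X z \<Otimes>\<^sub>M borel)"
    and A2c: "\<And>\<omega> y. \<omega> \<in> space M \<Longrightarrow>
      openin (L_sel_weak M X z) {u \<in> L_sel M X z. y \<in> level_cut (A (\<omega>, u)) (a u)}"
    and A2d: "\<And>\<omega> V. \<omega> \<in> space M \<Longrightarrow> open V \<Longrightarrow>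
      openin (L_sel_weak M X z) {u \<in> L_sel M X z. closure (level_cut (A (\<omega>, u)) (a u)) \<subseteq> V}"
  shows "\<exists>u \<in> L_sel M X z. \<forall>f\<in>u. AE \<omega> in M. f \<omega> \<in> closure (level_cut (A (\<omega>, u)) (a u))"
proof -
  let ?K = "\<lambda>\<omega>. level_cut (X \<omega>) z"
  obtain h :: "'a \<Rightarrow> real" where h: "integrable M h" "AE \<omega> in M. (SUP x\<in>?K \<omega>. ereal (norm x)) \<le> ereal (h \<omega>)"
    using A1a(2) unfolding integrably_bounded_def by blast
  interpret finite_measure M by fact
  interpret wc_correspondence M ?K "\<lambda>\<omega>. \<bar>h \<omega>\<bar>"
  proof
    show "AE \<omega> in M. \<forall>y\<in>?K \<omega>. norm y \<le> \<bar>h \<omega>\<bar>"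
      using h(2)
    proof eventually_elim
      fix \<omega> assume "(SUP x\<in>?K \<omega>. ereal (norm x)) \<le> ereal (h \<omega>)"
      then have "\<forall>x\<in>?K \<omega>. norm x \<le> h \<omega>" unfolding SUP_le_iff by simp
      then show "\<forall>y\<in>?K \<omega>. norm y \<le> \<bar>h \<omega>\<bar>" by force
    qed
  qed (use A1a(1) h(1) in auto)
  have L: "L_sel M X z = sel_classes"
  proof (intro equalityI subsetI)
    fix u assume "u \<in> L_sel M X z"
    then obtain f where f: "integrable M f" "u = L1_class M f" and sel_u: "\<forall>f\<in>u. AE \<omega> in M. f \<omega> \<in> ?K \<omega>"
      by (auto simp: L_sel_def L1_space_def)
    then have "f \<in> sel" using L1_class_self[OF f(1)] by (auto simp: sel_def)
    with f(2) show "u \<in> sel_classes" by (simp add: sel_classes_def)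
  next
    fix u assume u: "u \<in> sel_classes"
    then obtain f where f: "f \<in> sel" "u = L1_class M f" by (auto simp: sel_classes_def)
    have "AE \<omega> in M. g \<omega> \<in> ?K \<omega>" if "g \<in> u" for g
      using that sel_in[OF f(1)] unfolding f(2) L1_class_def by (auto elim: eventually_elim2)
    with u sel_classes_L1 show "u \<in> L_sel M X z" by (auto simp: L_sel_def)
  qed
  show ?thesis
    unfolding L
  proof (rule random_fixed_point[where C = "\<lambda>\<omega> u. level_cut (A (\<omega>, u)) (a u)"])
    fix u assume u: "u \<in> sel_classes"
    show "lower_measurable M (\<lambda>\<omega>. level_cut (A (\<omega>, u)) (a u))"
      using A a[of u] u unfolding random_fuzzy_mapping_def L by auto
    fix \<omega> assume \<omega>: "\<omega> \<in> space M"
    have "level_cut (A (\<omega>, u)) (a u) \<noteq> {}"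
      using A2a[OF \<omega>] u interior_of_subset unfolding L by fastforce
    then show "level_cut (A (\<omega>, u)) (a u) \<noteq> {} \<and> level_cut (A (\<omega>, u)) (a u) \<subseteq> ?K \<omega> \<and> convex (level_cut (A (\<omega>, u)) (a u))"
      using A2a[OF \<omega>] A_sub_X[OF \<omega>] u unfolding L by blast
  qed (use A1a(1) A1b A2d assms(3) in \<open>auto simp: L_sel_weak_def L\<close>)
qed

end
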